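(* Let $G$ be a hyperbolic group and let $M=\partial G$ be its Gromov boundary, with the usual $G$-action. Assume that $M$ is non-degenerate, path connected and has no path cut point, and let $\mathcal{D}$ be a $G$-finite, point-convergent collection of $G$-full divisions of $M$. Let $v$ be a vertex of the dual cube complex $X(\mathcal{D})$, with stabilizer $G_v$. Then $$\Lambda(G_v)=\bigcap_{D\in\mathcal{D}}\bigl(h_v(D)\cup C_D\bigr),$$ where $\Lambda(G_v)\subseteq M$ is the limit set of $G_v$ and $h_v(D)\in\{M_D^+,M_D^-\}$ is the side of $D$ chosen by the ultrafilter $v$.
   Context: Divisions. A division of a topological space $M$ is a pair $D=(C_D,\{M_D^+,M_D^-\})$ such that (1) $C_D\subset M$ is closed and nowhere dense; (2) $M\setminus C_D=M_D^+\sqcup M_D^-$ with $M_D^+,M_D^-$ nonempty and clopen in $M\setminus C_D$; (3) $\overline{M_D^{\epsilon}}=M_D^{\epsilon}\cup C_D$ for each $\epsilon\in\{+,-\}$. If $G$ acts on $M$ by homeomorphisms, $gD=(gC_D,\{gM_D^+,gM_D^-\})$; $\mathrm{Stab}(D)$ is the stabilizer of $D$ for this action (its elements may exchange $M_D^+$ and $M_D^-$), $\mathrm{Stab}(C_D)$ is the setwise stabilizer of $C_D$, and $D$ is $G$-full if $\mathrm{Stab}(D)$ has finite index in $\mathrm{Stab}(C_D)$. A collection is $G$-finite if it is $G$-invariant and consists of finitely many $G$-orbits. A collection $\mathcal{C}$ of subsets of $M$ is point-convergent if for every sequence $(C_i)_{i\in\mathbb{N}}$ of distinct elements of $\mathcal{C}$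 the set $\lim_{i\to\infty} C_i$, consisting of the points of $M$ that are limits of sequences $(x_i)$ with $x_i\in C_i$, has at most one point. A collection $\mathcal{D}$ of divisions is point-convergent if $\{D\in\mathcal{D}\mid C_D=C\}$ is finite for every $C\subset M$ and $\{C_D\mid D\in\mathcal{D}\}$ is point-convergent. A path cut point of a path connected space $Y$ is a point $p$ for which there exist $a,b\in Y\setminus\{p\}$ such that every path from $a$ to $b$ passes through $p$. Non-degenerate means having more than one point. The complex $X(\mathcal{D})$. Let $M_{\mathcal{D}}=M\setminus\bigcup_{D\in\mathcal{D}}C_D$ and let $\Theta_{\mathcal{D}}$ be the set of unordered triples of distinct points of $M_{\mathcal{D}}$. For $D\in\mathcal{D}$ let $W_D^{\pm}=\{t\in\Theta_{\mathcal{D}}\mid \#(t\cap M_D^{\pm})\ge 2\}$; these are the halfspaces, and $W_D=\{W_D^+,W_D^-\}$ is a wall. An ultrafilter is a set $\alpha$ of halfspaces containing exactly one of $W_D^+,W_D^-$ for each $D\in\mathcal{D}$ and such that $A\in\alpha$, $A\subseteq B$ with $B$ a halfspace implies $B\in\alpha$. It is DCC if every descending chain of its elements terminates. It is principal if it equals $\alpha_t=\{A\mid t\in A\}$ for some $t\in\Theta_{\mathcal{D}}$. Let $Z$ be the cube complex whose vertices are the DCC ultrafilters, with $\alpha,\alpha'$ joined by an edge iff $\alpha'=(\alpha\setminus\{A\})\cup\{\Theta_{\mathcal{D}}\setminus A\}$ for some $A$ minimal in $\alpha$ under inclusion, and with an $n$-cube ($n>1$) attached whenever the $(n-1)$-skeleton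 of an $n$-cube appears. $X(\mathcal{D})$ is the connected component of $Z$ containing the principal ultrafilters; it is a $\mathrm{CAT}(0)$ cube complex on which $G$ acts by $g\alpha=\{gA\mid A\in\alpha\}$. For a vertex $v$ and $D\in\mathcal{D}$, $h_v(D)=M_D^{\epsilon}$ where $\epsilon\in\{+,-\}$ is such that $W_D^{\epsilon}\in v$. The limit set $\Lambda(H)$ of a subgroup $H\le G$ is the set of accumulation points in $\partial G$ of an $H$-orbit in $G$ (empty if $H$ is finite). *)

theory Defs
  imports "HOL-Analysis.Analysis" "HOL-Algebra.Generated_Groups" "HOL-Algebra.Group_Action"
begin

section \<open>Hyperbolic groups\<close>

definition word_norm :: "('a, 'b) monoid_scheme \<Rightarrow> 'a set \<Rightarrow> 'a \<Rightarrow> nat" where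
  "word_norm G S g = (LEAST n. \<exists>ws. length ws = n \<and> set ws \<subseteq> S \<union> m_inv G ` S \<and>
                                foldr (\<otimes>\<^bsub>G\<^esub>) ws \<one>\<^bsub>G\<^esub> = g)"

definition word_dist :: "('a, 'b) monoid_scheme \<Rightarrow> 'a set \<Rightarrow> 'a \<Rightarrow> 'a \<Rightarrow> nat" where
  "word_dist G S g h = word_norm G S (inv\<^bsub>G\<^esub> g \<otimes>\<^bsub>G\<^esub> h)"

definition gromov_product :: "('a, 'b) monoid_scheme \<Rightarrow> 'a set \<Rightarrow> 'a \<Rightarrow> 'a \<Rightarrow> 'a \<Rightarrow> real" where
  "gromov_product G S w x y =
     (real (word_dist G S w x) + real (word_dist G S w y) - real (word_dist G S x y)) / 2"

text \<open>The finite generating set \<open>S\<close> is a parameter because the boundary below is built from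
  its word metric. Hyperbolicity does not depend on the choice of \<open>S\<close>, and neither do the
  boundary (as a set of classes of sequences) nor its topology, so nothing is lost by
  quantifying over \<open>S\<close>.\<close>

locale hyperbolic_group = group G for G (structure) +
  fixes S
  assumes finite_gens: "finite S"
    and gens_subset: "S \<subseteq> carrier G"
    and gens_generate: "generate G S = carrier G"
    and hyperbolic: "\<exists>\<delta>. \<forall>w\<in>carrier G. \<forall>x\<in>carrier G. \<forall>y\<in>carrier G. \<forall>z\<in>carrier G.
       min (gromov_product G S w x y) (gromov_product G S w y z) - \<delta> \<le> gromov_product G S w x z"


section \<open>The Gromov boundary and its topology\<close>

text \<open>Boundary points are equivalence classes of sequences converging to infinity.\<close>

type_synonym 'a bpoint = "(nat \<Rightarrow> 'a) set"

definition seqs_to_infinity :: "('a, 'b) monoid_scheme \<Rightarrow> 'a set \<Rightarrow> (nat \<Rightarrow> 'a) set" where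
  "seqs_to_infinity G S = {x. range x \<subseteq> carrier G \<and>
     filterlim (\<lambda>(i, j). gromov_product G S \<one>\<^bsub>G\<^esub> (x i) (x j)) at_top (sequentially \<times>\<^sub>F sequentially)}"

definition seqs_equiv :: "('a, 'b) monoid_scheme \<Rightarrow> 'a set \<Rightarrow> ((nat \<Rightarrow> 'a) \<times> (nat \<Rightarrow> 'a)) set" where
  "seqs_equiv G S = {(x, y). x \<in> seqs_to_infinity G S \<and> y \<in> seqs_to_infinity G S \<and>
     filterlim (\<lambda>(i, j). gromov_product G S \<one>\<^bsub>G\<^esub> (x i) (y j)) at_top (sequentially \<times>\<^sub>F sequentially)}"

definition gromov_boundary :: "('a, 'b) monoid_scheme \<Rightarrow> 'a set \<Rightarrow> 'a bpoint set" where
  "gromov_boundary G S = seqs_to_infinity G S // seqs_equiv G S"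

text \<open>To treat \<open>G \<union> \<partial>G\<close> as one space, a group element is represented by the singleton of its
  constant sequence; these classes are disjoint from the boundary points, since the latter
  contain only sequences that converge to infinity.\<close>

definition group_point :: "'a \<Rightarrow> 'a bpoint" where
  "group_point g = {\<lambda>_. g}"

definition bordification :: "('a, 'b) monoid_scheme \<Rightarrow> 'a set \<Rightarrow> 'a bpoint set" where
  "bordification G S = group_point ` carrier G \<union> gromov_boundary G S"

text \<open>The usual extension of the Gromov product based at the identity:
  \<open>(\<xi>|\<eta>) = sup liminf (x\<^sub>i|y\<^sub>j)\<close> over all representatives.\<close>

definition ext_gromov_product ::
    "('a, 'b) monoid_scheme \<Rightarrow> 'a set \<Rightarrow> 'a bpoint \<Rightarrow> 'a bpoint \<Rightarrow> ereal" where
  "ext_gromov_product G S \<xi> \<eta> = (SUP x\<in>\<xi>. SUP y\<in>\<eta>.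
     Liminf (sequentially \<times>\<^sub>F sequentially)
       (\<lambda>(i, j). ereal (gromov_product G S \<one>\<^bsub>G\<^esub> (x i) (y j))))"

text \<open>The topology of \<open>G \<union> \<partial>G\<close> in which points of \<open>G\<close> are isolated and the sets
  \<open>{p. (\<xi>|p) > r}\<close> form a neighbourhood basis at each \<open>\<xi> \<in> \<partial>G\<close>.\<close>

definition bordification_topology :: "('a, 'b) monoid_scheme \<Rightarrow> 'a set \<Rightarrow> 'a bpoint topology" where
  "bordification_topology G S = topology (\<lambda>U. U \<subseteq> bordification G S \<and>
     (\<forall>\<xi>\<in>U \<inter> gromov_boundary G S. \<exists>r::real.
        {p \<in> bordification G S. ext_gromov_product G S \<xi> p > ereal r} \<subseteq> U))"

lemma openin_bordification_topology:
  "openin (bordification_topology G S) U \<longleftrightarrow> U \<subseteq> bordification G S \<and>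
     (\<forall>\<xi>\<in>U \<inter> gromov_boundary G S. \<exists>r::real.
        {p \<in> bordification G S. ext_gromov_product G S \<xi> p > ereal r} \<subseteq> U)"
proof -
  let ?N = "\<lambda>\<xi> r. {p \<in> bordification G S. ext_gromov_product G S \<xi> p > ereal r}"
  let ?P = "\<lambda>U. U \<subseteq> bordification G S \<and> (\<forall>\<xi>\<in>U \<inter> gromov_boundary G S. \<exists>r::real. ?N \<xi> r \<subseteq> U)"
  have "istopology ?P"
    unfolding istopology_def
  proof (intro conjI allI impI)
    fix U V assume U: "?P U" and V: "?P V"
    show "U \<inter> V \<subseteq> bordification G S" using U by blast
    show "\<forall>\<xi>\<in>(U \<inter> V) \<inter> gromov_boundary G S. \<exists>r::real. ?N \<xi> r \<subseteq> U \<inter> V"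
    proof
      fix \<xi> assume "\<xi> \<in> (U \<inter> V) \<inter> gromov_boundary G S"
      then obtain r s where "?N \<xi> r \<subseteq> U" "?N \<xi> s \<subseteq> V" using U V by blast
      moreover have "?N \<xi> (max r s) \<subseteq> ?N \<xi> r \<inter> ?N \<xi> s"
        by (auto intro: le_less_trans[rotated])
      ultimately show "\<exists>r::real. ?N \<xi> r \<subseteq> U \<inter> V" by blast
    qed
  next
    fix K assume K: "\<forall>U\<in>K. ?P U"
    show "\<Union>K \<subseteq> bordification G S" using K by blast
    show "\<forall>\<xi>\<in>\<Union>K \<inter> gromov_boundary G S. \<exists>r::real. ?N \<xi> r \<subseteq> \<Union>K"
    proof
      fix \<xi> assume "\<xi> \<in> \<Union>K \<inter> gromov_boundary G S"
      then obtain U where "U \<in> K" "\<xi> \<in> U \<inter> gromov_boundary G S" by blast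
      then obtain r where "?N \<xi> r \<subseteq> U" using K by blast
      then show "\<exists>r::real. ?N \<xi> r \<subseteq> \<Union>K" using \<open>U \<in> K\<close> by blast
    qed
  qed
  then show ?thesis
    unfolding bordification_topology_def by (simp add: topology_inverse')
qed

lemma topspace_bordification_topology [simp]:
  "topspace (bordification_topology G S) = bordification G S"
proof
  show "topspace (bordification_topology G S) \<subseteq> bordification G S"
    unfolding topspace_def by (auto simp: openin_bordification_topology)
  have "openin (bordification_topology G S) (bordification G S)"
    by (auto simp: openin_bordification_topology)
  then show "bordification G S \<subseteq> topspace (bordification_topology G S)"
    by (rule openin_subset)
qed

definition boundary_topology :: "('a, 'b) monoid_scheme \<Rightarrow> 'a set \<Rightarrow> 'a bpoint topology" where
  "boundary_topology G S = subtopology (bordification_topology G S) (gromov_boundary G S)"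

lemma topspace_boundary_topology [simp]:
  "topspace (boundary_topology G S) = gromov_boundary G S"
  by (auto simp: boundary_topology_def bordification_def)

text \<open>Left translation of representatives. It maps a class onto a whole class, because left
  translation by the inverse maps back.\<close>

definition boundary_act :: "('a, 'b) monoid_scheme \<Rightarrow> 'a \<Rightarrow> 'a bpoint \<Rightarrow> 'a bpoint" where
  "boundary_act G g \<xi> = (\<lambda>x i. g \<otimes>\<^bsub>G\<^esub> x i) ` \<xi>"

text \<open>\<open>H\<close> itself is the \<open>H\<close>-orbit of the identity.\<close>

definition limit_set :: "('a, 'b) monoid_scheme \<Rightarrow> 'a set \<Rightarrow> 'a set \<Rightarrow> 'a bpoint set" where
  "limit_set G S H =
     gromov_boundary G S \<inter> (bordification_topology G S) derived_set_of (group_point ` H)"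


section \<open>Path cut points\<close>

definition path_cut_point :: "'m topology \<Rightarrow> 'm \<Rightarrow> bool" where
  "path_cut_point X p \<longleftrightarrow> p \<in> topspace X \<and>
     (\<exists>a\<in>topspace X - {p}. \<exists>b\<in>topspace X - {p}.
        \<forall>\<gamma>. pathin X \<gamma> \<and> \<gamma> 0 = a \<and> \<gamma> 1 = b \<longrightarrow> p \<in> \<gamma> ` {0..1})"


section \<open>Divisions\<close>

text \<open>A division is a pair \<open>(C, {M\<^sup>+, M\<^sup>-})\<close> whose second component is unordered.\<close>

type_synonym 'm division = "'m set \<times> 'm set set"

definition is_division :: "'m topology \<Rightarrow> 'm division \<Rightarrow> bool" where
  "is_division X D \<longleftrightarrow>
     closedin X (fst D) \<and> X interior_of (X closure_of (fst D)) = {} \<and>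
     (\<exists>A B. snd D = {A, B} \<and> A \<inter> B = {} \<and> A \<union> B = topspace X - fst D \<and>
       (\<forall>E\<in>{A, B}. E \<noteq> {} \<and>
          openin (subtopology X (topspace X - fst D)) E \<and>
          closedin (subtopology X (topspace X - fst D)) E \<and>
          X closure_of E = E \<union> fst D))"

definition division_act :: "('g \<Rightarrow> 'm \<Rightarrow> 'm) \<Rightarrow> 'g \<Rightarrow> 'm division \<Rightarrow> 'm division" where
  "division_act \<phi> g D = (\<phi> g ` fst D, (\<lambda>E. \<phi> g ` E) ` snd D)"

definition full_division ::
    "('g, 'b) monoid_scheme \<Rightarrow> ('g \<Rightarrow> 'm \<Rightarrow> 'm) \<Rightarrow> 'm division \<Rightarrow> bool" where
  "full_division G \<phi> D \<longleftrightarrow>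
     finite (rcosets\<^bsub>G\<lparr>carrier := stabilizer G (\<lambda>g C. \<phi> g ` C) (fst D)\<rparr>\<^esub>
               (stabilizer G (division_act \<phi>) D))"

definition G_finite ::
    "('g, 'b) monoid_scheme \<Rightarrow> ('g \<Rightarrow> 'm \<Rightarrow> 'm) \<Rightarrow> 'm division set \<Rightarrow> bool" where
  "G_finite G \<phi> \<D> \<longleftrightarrow>
     (\<forall>g\<in>carrier G. \<forall>D\<in>\<D>. division_act \<phi> g D \<in> \<D>) \<and>
     finite (orbits G \<D> (division_act \<phi>))"

definition lim_sets :: "'m topology \<Rightarrow> (nat \<Rightarrow> 'm set) \<Rightarrow> 'm set" where
  "lim_sets X C = {p. \<exists>x. (\<forall>i. x i \<in> C i) \<and> limitin X x p sequentially}"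

definition point_convergent_sets :: "'m topology \<Rightarrow> 'm set set \<Rightarrow> bool" where
  "point_convergent_sets X \<C> \<longleftrightarrow>
     (\<forall>C::nat \<Rightarrow> 'm set. inj C \<and> range C \<subseteq> \<C> \<longrightarrow>
        (\<forall>p\<in>lim_sets X C. \<forall>q\<in>lim_sets X C. p = q))"

definition point_convergent :: "'m topology \<Rightarrow> 'm division set \<Rightarrow> bool" where
  "point_convergent X \<D> \<longleftrightarrow>
     (\<forall>C\<subseteq>topspace X. finite {D \<in> \<D>. fst D = C}) \<and> point_convergent_sets X (fst ` \<D>)"


section \<open>The dual cube complex\<close>

definition triples :: "'m topology \<Rightarrow> 'm division set \<Rightarrow> 'm set set" where
  "triples X \<D> = {t. t \<subseteq> topspace X - (\<Union>D\<in>\<D>. fst D) \<and> card t = 3}"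

definition halfspace :: "'m topology \<Rightarrow> 'm division set \<Rightarrow> 'm set \<Rightarrow> 'm set set" where
  "halfspace X \<D> E = {t \<in> triples X \<D>. 2 \<le> card (t \<inter> E)}"

definition wall :: "'m topology \<Rightarrow> 'm division set \<Rightarrow> 'm division \<Rightarrow> 'm set set set" where
  "wall X \<D> D = halfspace X \<D> ` snd D"

definition halfspaces :: "'m topology \<Rightarrow> 'm division set \<Rightarrow> 'm set set set" where
  "halfspaces X \<D> = (\<Union>D\<in>\<D>. wall X \<D> D)"

definition wall_ultrafilter :: "'m topology \<Rightarrow> 'm division set \<Rightarrow> 'm set set set \<Rightarrow> bool" where
  "wall_ultrafilter X \<D> \<alpha> \<longleftrightarrow>
     \<alpha> \<subseteq> halfspaces X \<D> \<and>
     (\<forall>D\<in>\<D>. \<exists>!A. A \<in> wall X \<D> D \<and> A \<in> \<alpha>) \<and>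
     (\<forall>A\<in>\<alpha>. \<forall>B\<in>halfspaces X \<D>. A \<subseteq> B \<longrightarrow> B \<in> \<alpha>)"

definition DCC :: "'a set set \<Rightarrow> bool" where
  "DCC \<alpha> \<longleftrightarrow> (\<forall>A::nat \<Rightarrow> 'a set. range A \<subseteq> \<alpha> \<and> decseq A \<longrightarrow> (\<exists>N. \<forall>n\<ge>N. A n = A N))"

definition principal_ultrafilter ::
    "'m topology \<Rightarrow> 'm division set \<Rightarrow> 'm set \<Rightarrow> 'm set set set" where
  "principal_ultrafilter X \<D> t = {A \<in> halfspaces X \<D>. t \<in> A}"

text \<open>The big complex \<open>Z\<close>, given by its vertices, its edges and the vertex sets of its cubes.\<close>

definition Z_vertices :: "'m topology \<Rightarrow> 'm division set \<Rightarrow> 'm set set set set" where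
  "Z_vertices X \<D> = {\<alpha>. wall_ultrafilter X \<D> \<alpha> \<and> DCC \<alpha>}"

definition Z_edge ::
    "'m topology \<Rightarrow> 'm division set \<Rightarrow> 'm set set set \<Rightarrow> 'm set set set \<Rightarrow> bool" where
  "Z_edge X \<D> \<alpha> \<alpha>' \<longleftrightarrow> \<alpha> \<in> Z_vertices X \<D> \<and> \<alpha>' \<in> Z_vertices X \<D> \<and>
     (\<exists>A\<in>\<alpha>. (\<forall>B\<in>\<alpha>. \<not> B \<subset> A) \<and> \<alpha>' = (\<alpha> - {A}) \<union> {triples X \<D> - A})"

text \<open>An \<open>n\<close>-cube is attached whenever its \<open>(n-1)\<close>-skeleton appears; by induction on \<open>n\<close> this
  happens exactly when its 1-skeleton, the graph on the subsets of \<open>{..<n}\<close>, appears in the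
  graph of \<open>Z\<close>. The cases \<open>n = 0\<close> and \<open>n = 1\<close> give the vertices and edges.\<close>

definition Z_cubes :: "'m topology \<Rightarrow> 'm division set \<Rightarrow> 'm set set set set set" where
  "Z_cubes X \<D> = {f ` Pow {..<n} | (n::nat) f.
     inj_on f (Pow {..<n}) \<and> f ` Pow {..<n} \<subseteq> Z_vertices X \<D> \<and>
     (\<forall>s\<subseteq>{..<n}. \<forall>i\<in>{..<n} - s. Z_edge X \<D> (f s) (f (insert i s)))}"

text \<open>Vertices of the connected component of \<open>Z\<close> containing the principal ultrafilters.\<close>

definition dual_complex_vertices :: "'m topology \<Rightarrow> 'm division set \<Rightarrow> 'm set set set set" where
  "dual_complex_vertices X \<D> = {v \<in> Z_vertices X \<D>. \<exists>t\<in>triples X \<D>.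
     (principal_ultrafilter X \<D> t, v) \<in> {(\<alpha>, \<beta>). \<exists>Q\<in>Z_cubes X \<D>. \<alpha> \<in> Q \<and> \<beta> \<in> Q}\<^sup>*}"

text \<open>The induced action: \<open>g\<close> moves points, hence triples, halfspaces and sets of halfspaces.\<close>

definition ultrafilter_act :: "('g \<Rightarrow> 'm \<Rightarrow> 'm) \<Rightarrow> 'g \<Rightarrow> 'm set set set \<Rightarrow> 'm set set set" where
  "ultrafilter_act \<phi> g \<alpha> = (\<lambda>A. (\<lambda>t. \<phi> g ` t) ` A) ` \<alpha>"

definition chosen_side ::
    "'m topology \<Rightarrow> 'm division set \<Rightarrow> 'm set set set \<Rightarrow> 'm division \<Rightarrow> 'm set" where
  "chosen_side X \<D> v D = (THE E. E \<in> snd D \<and> halfspace X \<D> E \<in> v)"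

end

theory Submission
  imports Defs "HOL-Library.Diagonal_Subsequence"
begin

text \<open>Zoom in on a boundary point \<open>p\<close> along group elements \<open>g\<^sub>n\<close> near a ray to \<open>p\<close>: then
  \<open>g\<^sub>n\<inverse>p \<rightarrow> a\<close>, while \<open>g\<^sub>n\<inverse>x \<rightarrow> b \<noteq> a\<close> for all \<open>x \<noteq> p\<close>, locally uniformly. Since there are no
  path cut points every wall has at least two points, so zooming in on a point of a wall and
  point-convergence show that this point is conical for the stabilizer of the division. It follows
  that among distinct divisions one closed side shrinks to a point. A vertex \<open>v\<close> chooses, up to
  finitely many exceptions, sides containing two points of a fixed triple, so the sides chosen by
  \<open>v\<close> cannot shrink. If \<open>g\<^sub>n \<in> G\<^sub>v\<close> converges to a point off the closure of a chosen side, then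
  the translates of that side by \<open>g\<^sub>n\<inverse>\<close> are chosen sides that shrink, which is absurd. If \<open>p\<close> lies
  in the closure of every chosen side, then the vertices \<open>g\<^sub>n\<inverse>v\<close> take finitely many values, so that
  infinitely many \<open>g\<^sub>n\<close> lie in one coset \<open>G\<^sub>v u\<close> and \<open>p\<close> is a limit point of \<open>G\<^sub>v\<close>.\<close>

section \<open>The word metric\<close>

text \<open>The recurring obstacle is a family of closed sides that crowds onto the repelling point
  of a sequence, where contraction says nothing. For translates of one division it is met by
  minimality: a representative of least length in its coset of the stabilizer cannot have its
  inverse approach a wall point, because a stabilizer element running towards that point would
  shorten it. This is why conicality of wall points has to precede any statement about sides. For
  the sides chosen by \<open>v\<close> it is met by a radius that works for all divisions at once,
  so that the division may vary along the sequence. Which sides a translate of \<open>v\<close>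
  chooses is recorded against one fixed triple: the triple decides every wall, so the set of
  divisions at which the translate disagrees with it determines the choice. Gromov products of
  boundary points are controlled only up to multiples of \<delta>; hence nearness carries a real
  parameter, used for arbitrarily large values, and the constants below count uses of the hyperbolic
  inequality.\<close>

context hyperbolic_group
begin

abbreviation gens :: "'a set" where "gens \<equiv> S \<union> m_inv G ` S"

abbreviation wprod :: "'a list \<Rightarrow> 'a" where "wprod ws \<equiv> foldr (\<otimes>) ws \<one>"

abbreviation len :: "'a \<Rightarrow> nat" where "len \<equiv> word_norm G S"

abbreviation gp :: "'a \<Rightarrow> 'a \<Rightarrow> real" where "gp \<equiv> gromov_product G S \<one>"

lemma gens_closed: "gens \<subseteq> carrier G"
  using gens_subset by auto

lemma wprod_closed: "set ws \<subseteq> gens \<Longrightarrow> wprod ws \<in> carrier G"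
  using gens_closed by (induction ws) auto

lemma wprod_append:
  "set us \<subseteq> gens \<Longrightarrow> set ws \<subseteq> gens \<Longrightarrow> wprod (us @ ws) = wprod us \<otimes> wprod ws"
proof (induction us)
  case Nil
  then show ?case using wprod_closed by simp
next
  case (Cons a us)
  have "a \<in> carrier G" using Cons.prems gens_closed by auto
  moreover have "wprod us \<in> carrier G" "wprod ws \<in> carrier G" using Cons.prems wprod_closed by auto
  ultimately show ?case using Cons by (simp add: m_assoc)
qed

lemma inv_gens: "a \<in> gens \<Longrightarrow> inv a \<in> gens"
  using gens_subset by (auto simp: subsetD)

lemma inv_wprod:
  "set ws \<subseteq> gens \<Longrightarrow> inv (wprod ws) = wprod (rev (map (m_inv G) ws))"
proof (induction ws)
  case Nil
  then show ?case by simp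
next
  case (Cons a ws)
  have a: "a \<in> gens" "a \<in> carrier G" using Cons.prems gens_closed by auto
  have ws: "set ws \<subseteq> gens" "wprod ws \<in> carrier G" using Cons.prems wprod_closed by auto
  have "set (rev (map (m_inv G) ws)) \<subseteq> gens" using ws(1) inv_gens by auto
  then have "wprod (rev (map (m_inv G) ws) @ [inv a]) = wprod (rev (map (m_inv G) ws)) \<otimes> wprod [inv a]"
    using a(1) by (intro wprod_append) (use inv_gens in auto)
  then show ?case using a ws Cons.IH by (simp add: inv_mult_group)
qed

lemma ex_word:
  assumes "g \<in> carrier G"
  shows "\<exists>ws. set ws \<subseteq> gens \<and> wprod ws = g"
proof -
  have "g \<in> generate G S" using assms gens_generate by simp
  then show ?thesis
  proof induction
    case one
    show ?case by (intro exI[of _ "[]"]) simp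
  next
    case (incl h)
    then have "h \<in> carrier G" using gens_subset by auto
    with incl show ?case by (intro exI[of _ "[h]"]) simp
  next
    case (inv h)
    then have "h \<in> carrier G" using gens_subset by auto
    with inv show ?case by (intro exI[of _ "[inv h]"]) simp
  next
    case (eng h1 h2)
    then obtain us ws where "set us \<subseteq> gens" "wprod us = h1" "set ws \<subseteq> gens" "wprod ws = h2"
      by blast
    then have "set (us @ ws) \<subseteq> gens \<and> wprod (us @ ws) = h1 \<otimes> h2"
      using wprod_append by auto
    then show ?case by blast
  qed
qed

lemma len_le: "set ws \<subseteq> gens \<Longrightarrow> len (wprod ws) \<le> length ws"
  unfolding word_norm_def by (rule Least_le) blast

lemma ex_shortest_word:
  assumes "g \<in> carrier G"
  obtains ws where "set ws \<subseteq> gens" "wprod ws = g" "length ws = len g"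
proof -
  have "\<exists>n ws. length ws = n \<and> set ws \<subseteq> gens \<and> wprod ws = g"
    using ex_word[OF assms] by auto
  then have "\<exists>ws. length ws = len g \<and> set ws \<subseteq> gens \<and> wprod ws = g"
    unfolding word_norm_def by (rule LeastI_ex)
  then show thesis using that by blast
qed

lemma len_mult:
  assumes "g \<in> carrier G" "h \<in> carrier G"
  shows "len (g \<otimes> h) \<le> len g + len h"
proof -
  obtain us ws where w: "set us \<subseteq> gens" "wprod us = g" "length us = len g"
    "set ws \<subseteq> gens" "wprod ws = h" "length ws = len h"
    using ex_shortest_word assms by metis
  have "len (wprod (us @ ws)) \<le> length (us @ ws)" using w by (intro len_le) auto
  then show ?thesis using w wprod_append[OF w(1,4)] by simp
qed

lemma len_inv:
  assumes "g \<in> carrier G"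
  shows "len (inv g) = len g"
proof -
  have le: "len (inv h) \<le> len h" if h: "h \<in> carrier G" for h
  proof -
    obtain ws where w: "set ws \<subseteq> gens" "wprod ws = h" "length ws = len h"
      using ex_shortest_word h by metis
    have "set (rev (map (m_inv G) ws)) \<subseteq> gens" using w(1) inv_gens by auto
    from len_le[OF this] show ?thesis using w inv_wprod[OF w(1)] by simp
  qed
  from le[of g] le[of "inv g"] assms show ?thesis by simp
qed

lemma len_one: "len \<one> = 0"
  using len_le[of "[]"] by simp

text \<open>A shortest word is cut after \<open>k\<close> letters; by the triangle inequality both
  pieces are again shortest. Such a prefix stands in for the point at distance \<open>k\<close> on a
  geodesic from \<open>\<one>\<close> to \<open>g\<close>.\<close>

lemma len_prefix:
  assumes "g \<in> carrier G" "k \<le> len g"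
  obtains h where "h \<in> carrier G" "len h = k" "len (inv h \<otimes> g) = len g - k"
proof -
  obtain ws where w: "set ws \<subseteq> gens" "wprod ws = g" "length ws = len g"
    using ex_shortest_word assms by metis
  define h r where "h = wprod (take k ws)" and "r = wprod (drop k ws)"
  have sub: "set (take k ws) \<subseteq> gens" "set (drop k ws) \<subseteq> gens"
    using w(1) set_take_subset[of k ws] set_drop_subset[of k ws] by auto
  have g: "g = h \<otimes> r" unfolding h_def r_def using wprod_append[OF sub] w(2) by simp
  have c: "h \<in> carrier G" "r \<in> carrier G" unfolding h_def r_def using sub wprod_closed by blast+
  have "len h \<le> k" "len r \<le> len g - k"
    unfolding h_def r_def using len_le[OF sub(1)] len_le[OF sub(2)] w(3) by auto
  moreover have "len g \<le> len h + len r" using g len_mult c by simp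
  moreover have "inv h \<otimes> g = r" using g c by (simp add: m_assoc[symmetric])
  ultimately show thesis using that[of h] c assms(2) by simp
qed

text \<open>Finiteness of \<open>S\<close> enters here; it is the source of all compactness
  below.\<close>

lemma finite_ball: "finite {g \<in> carrier G. len g \<le> n}"
proof -
  have "finite gens" using finite_gens by simp
  then have "finite (wprod ` {ws. set ws \<subseteq> gens \<and> length ws \<le> n})"
    using finite_lists_length_le by blast
  moreover have "{g \<in> carrier G. len g \<le> n} \<subseteq> wprod ` {ws. set ws \<subseteq> gens \<and> length ws \<le> n}"
  proof
    fix g assume "g \<in> {g \<in> carrier G. len g \<le> n}"
    then show "g \<in> wprod ` {ws. set ws \<subseteq> gens \<and> length ws \<le> n}"
      using ex_shortest_word[of g] by (metis (mono_tags, lifting) image_eqI mem_Collect_eq)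
  qed
  ultimately show ?thesis using finite_subset by blast
qed

lemma filterlim_len_inj:
  assumes "inj f" "range f \<subseteq> carrier G"
  shows "filterlim (\<lambda>n. len (f n)) at_top sequentially"
  unfolding filterlim_at_top
proof
  fix N
  have "finite (f -` {g \<in> carrier G. len g \<le> N})"
    using finite_ball assms(1) by (rule finite_vimageI)
  then have "\<forall>\<^sub>F n in sequentially. n \<notin> f -` {g \<in> carrier G. len g \<le> N}"
    by (simp add: eventually_cofinite flip: cofinite_eq_sequentially)
  then show "\<forall>\<^sub>F n in sequentially. N \<le> len (f n)"
    by eventually_elim (use assms(2) in auto)
qed

section \<open>The Gromov product based at the identity and its behaviour under left
  translation\<close>

lemma gp_eq:
  assumes "x \<in> carrier G" "y \<in> carrier G"
  shows "gp x y = (real (len x) + real (len y) - real (len (inv x \<otimes> y))) / 2"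
  using assms by (simp add: gromov_product_def word_dist_def)

lemma gp_commute:
  assumes "x \<in> carrier G" "y \<in> carrier G"
  shows "gp x y = gp y x"
proof -
  have "inv (inv x \<otimes> y) = inv y \<otimes> x" using assms by (simp add: inv_mult_group)
  then have "len (inv y \<otimes> x) = len (inv x \<otimes> y)" using len_inv assms by (metis m_closed inv_closed)
  then show ?thesis using assms by (simp add: gp_eq)
qed

lemma gp_le_len:
  assumes "x \<in> carrier G" "y \<in> carrier G"
  shows "gp x y \<le> len x"
proof -
  have "len (x \<otimes> (inv x \<otimes> y)) \<le> len x + len (inv x \<otimes> y)" using assms by (intro len_mult) auto
  moreover have "x \<otimes> (inv x \<otimes> y) = y" using assms by (simp add: m_assoc[symmetric])
  ultimately show ?thesis using assms by (simp add: gp_eq)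
qed

lemma gp_self: "x \<in> carrier G \<Longrightarrow> gp x x = len x"
  by (simp add: gp_eq len_one)

lemma gp_prefix:
  assumes "g \<in> carrier G" "h \<in> carrier G" "len h \<le> len g" "len (inv h \<otimes> g) = len g - len h"
  shows "gp h g = len h"
  using assms by (simp add: gp_eq of_nat_diff)

lemma inv_mult_translate:
  assumes "g \<in> carrier G" "x \<in> carrier G" "y \<in> carrier G"
  shows "inv (g \<otimes> x) \<otimes> (g \<otimes> y) = inv x \<otimes> y"
proof -
  have "inv (g \<otimes> x) \<otimes> (g \<otimes> y) = inv x \<otimes> (inv g \<otimes> (g \<otimes> y))"
    using assms by (simp add: inv_mult_group m_assoc)
  also have "inv g \<otimes> (g \<otimes> y) = y" using assms by (simp add: m_assoc[symmetric])
  finally show ?thesis .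
qed

text \<open>Left translation preserves the distance term, and each of the two length terms drops by
  at most \<open>len g\<close>.\<close>

lemma gp_translate:
  assumes "g \<in> carrier G" "x \<in> carrier G" "y \<in> carrier G"
  shows "gp x y - len g \<le> gp (g \<otimes> x) (g \<otimes> y)"
proof -
  have *: "real (len z) \<le> real (len g) + real (len (g \<otimes> z))" if "z \<in> carrier G" for z
  proof -
    have "len (inv g \<otimes> (g \<otimes> z)) \<le> len (inv g) + len (g \<otimes> z)"
      using that assms by (intro len_mult) auto
    moreover have "inv g \<otimes> (g \<otimes> z) = z" using that assms by (simp add: m_assoc[symmetric])
    ultimately show ?thesis using len_inv assms by (simp flip: of_nat_add)
  qed
  show ?thesis
    unfolding gp_eq[OF assms(2,3)] gp_eq[OF m_closed[OF assms(1,2)] m_closed[OF assms(1,3)]]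
      inv_mult_translate[OF assms]
    using *[OF assms(2)] *[OF assms(3)] by (simp add: field_simps)
qed

text \<open>This is (x|z)_w + (w|z)_x = d(w,x) for w = 1, x = g, z = gy, with the second product
  moved back to the base point by \<open>inv g\<close>. It trades nearness to \<open>inv g\<close>
  before the translation against nearness to \<open>g\<close> after it.\<close>

lemma gp_inverse_sum:
  assumes "g \<in> carrier G" "y \<in> carrier G"
  shows "gp g (g \<otimes> y) + gp (inv g) y = len g"
proof -
  have "inv g \<otimes> (g \<otimes> y) = y" using assms by (simp add: m_assoc[symmetric])
  then show ?thesis using assms by (simp add: gp_eq len_inv field_simps)
qed

end

section \<open>Nearness in the bordification\<close>

lemma filterlim_prod_sequentially_at_top:
  fixes f :: "nat \<Rightarrow> nat \<Rightarrow> real"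
  shows "filterlim (\<lambda>(i, j). f i j) at_top (sequentially \<times>\<^sub>F sequentially) \<longleftrightarrow>
    (\<forall>r. \<exists>N. \<forall>i\<ge>N. \<forall>j\<ge>N. r \<le> f i j)"
proof -
  \<comment> \<open>\<open>eventually_prod_sequentially\<close> lists the two indices in the
    opposite order; with a common threshold the order is immaterial.\<close>
  have "(\<exists>N. \<forall>i\<ge>N. \<forall>j\<ge>N. r \<le> f j i) \<longleftrightarrow> (\<exists>N. \<forall>i\<ge>N. \<forall>j\<ge>N. r \<le> f i j)" for r
    by blast
  then show ?thesis
    unfolding filterlim_at_top eventually_prod_sequentially by simp
qed

text \<open>Only the base point \<open>\<one>\<close> is kept, since the boundary is built from it.
  A hyperbolicity constant may be enlarged, so it is taken nonnegative and losses of \<delta> can be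
  absorbed freely.\<close>

locale hyperbolic_group_const = hyperbolic_group G S for G (structure) and S +
  fixes \<delta> :: real
  assumes delta_nonneg: "0 \<le> \<delta>"
    and gp_triangle: "x \<in> carrier G \<Longrightarrow> y \<in> carrier G \<Longrightarrow> z \<in> carrier G \<Longrightarrow>
      min (gromov_product G S \<one> x y) (gromov_product G S \<one> y z) - \<delta> \<le> gromov_product G S \<one> x z"
begin

abbreviation bdry :: "'a bpoint set" where "bdry \<equiv> gromov_boundary G S"

abbreviation bord :: "'a bpoint set" where "bord \<equiv> bordification G S"

abbreviation act :: "'a \<Rightarrow> 'a bpoint \<Rightarrow> 'a bpoint" where "act \<equiv> boundary_act G"

lemma gp_triangle_ge:
  assumes "x \<in> carrier G" "y \<in> carrier G" "z \<in> carrier G" "r \<le> gp x y" "r \<le> gp y z"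
  shows "r - \<delta> \<le> gp x z"
  using gp_triangle[of x y z] assms by linarith

section \<open>Boundary points, their representatives, and coarse nearness\<close>

lemma seqs_to_infinity_iff:
  "x \<in> seqs_to_infinity G S \<longleftrightarrow>
    range x \<subseteq> carrier G \<and> (\<forall>r. \<exists>N. \<forall>i\<ge>N. \<forall>j\<ge>N. r \<le> gp (x i) (x j))"
  unfolding seqs_to_infinity_def filterlim_prod_sequentially_at_top by simp

lemma seqs_equiv_iff:
  "(x, y) \<in> seqs_equiv G S \<longleftrightarrow> x \<in> seqs_to_infinity G S \<and> y \<in> seqs_to_infinity G S \<and>
    (\<forall>r. \<exists>N. \<forall>i\<ge>N. \<forall>j\<ge>N. r \<le> gp (x i) (y j))"
  unfolding seqs_equiv_def filterlim_prod_sequentially_at_top by simp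

lemma equiv_seqs_equiv: "equiv (seqs_to_infinity G S) (seqs_equiv G S)"
proof (rule equivI)
  show "seqs_equiv G S \<subseteq> seqs_to_infinity G S \<times> seqs_to_infinity G S"
    by (auto simp: seqs_equiv_iff)
  show "refl_on (seqs_to_infinity G S) (seqs_equiv G S)"
    by (rule refl_onI) (auto simp: seqs_equiv_iff seqs_to_infinity_iff)
  show "sym (seqs_equiv G S)"
  proof (rule symI)
    fix x y assume xy: "(x, y) \<in> seqs_equiv G S"
    then have c: "x i \<in> carrier G" "y i \<in> carrier G" for i
      by (auto simp: seqs_equiv_iff seqs_to_infinity_iff)
    show "(y, x) \<in> seqs_equiv G S"
      using xy unfolding seqs_equiv_iff by (metis gp_commute c)
  qed
  show "trans (seqs_equiv G S)"
  proof (rule transI)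
    fix x y z assume xy: "(x, y) \<in> seqs_equiv G S" and yz: "(y, z) \<in> seqs_equiv G S"
    then have c: "x i \<in> carrier G" "y i \<in> carrier G" "z i \<in> carrier G" for i
      by (auto simp: seqs_equiv_iff seqs_to_infinity_iff)
    have "\<exists>N. \<forall>i\<ge>N. \<forall>j\<ge>N. r \<le> gp (x i) (z j)" for r
    proof -
      obtain N where N: "\<And>i j. i \<ge> N \<Longrightarrow> j \<ge> N \<Longrightarrow> r + \<delta> \<le> gp (x i) (y j)"
        using xy unfolding seqs_equiv_iff by meson
      obtain M where M: "\<And>i j. i \<ge> M \<Longrightarrow> j \<ge> M \<Longrightarrow> r + \<delta> \<le> gp (y i) (z j)"
        using yz unfolding seqs_equiv_iff by meson
      have "r \<le> gp (x i) (z j)" if "i \<ge> max N M" "j \<ge> max N M" for i j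
      proof -
        have "r + \<delta> \<le> gp (x i) (y (max N M))" "r + \<delta> \<le> gp (y (max N M)) (z j)"
          using N M that by simp_all
        from gp_triangle_ge[OF c(1,2,3) this] show ?thesis by linarith
      qed
      then show ?thesis by blast
    qed
    then show "(x, z) \<in> seqs_equiv G S"
      using xy yz by (simp add: seqs_equiv_iff)
  qed
qed

lemma bdry_subset_bord: "bdry \<subseteq> bord"
  by (auto simp: bordification_def)

lemma group_point_bord: "g \<in> carrier G \<Longrightarrow> group_point g \<in> bord"
  by (auto simp: bordification_def)

lemma bdry_rep:
  assumes "p \<in> bdry" "x \<in> p"
  shows "x \<in> seqs_to_infinity G S" "p = seqs_equiv G S `` {x}"
proof -
  show x: "x \<in> seqs_to_infinity G S"
    using assms in_quotient_imp_subset[OF equiv_seqs_equiv] unfolding gromov_boundary_def by blast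
  from x have "x \<in> seqs_equiv G S `` {x}"
    using equiv_class_self[OF equiv_seqs_equiv] by blast
  moreover have "seqs_equiv G S `` {x} \<in> bdry"
    unfolding gromov_boundary_def using x by (rule quotientI)
  ultimately show "p = seqs_equiv G S `` {x}"
    using assms quotient_disj[OF equiv_seqs_equiv] unfolding gromov_boundary_def by blast
qed

lemma bdryI: "x \<in> seqs_to_infinity G S \<Longrightarrow> seqs_equiv G S `` {x} \<in> bdry"
  unfolding gromov_boundary_def by (rule quotientI)

lemma bord_ex_rep: "p \<in> bord \<Longrightarrow> \<exists>x. x \<in> p"
  unfolding ex_in_conv using in_quotient_imp_non_empty[OF equiv_seqs_equiv]
  by (auto simp: bordification_def gromov_boundary_def group_point_def)

lemma bord_carrier:
  assumes "p \<in> bord" "x \<in> p"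
  shows "x i \<in> carrier G"
  using assms bdry_rep(1)[of p x]
  by (auto simp: bordification_def group_point_def seqs_to_infinity_iff)

lemma bdry_reps_close:
  assumes "p \<in> bdry" "x \<in> p" "y \<in> p"
  shows "\<exists>N. \<forall>i\<ge>N. \<forall>j\<ge>N. r \<le> gp (x i) (y j)"
  using bdry_rep(2)[OF assms(1,2)] assms(3) by (auto simp: seqs_equiv_iff)

text \<open>A group element has one constant representative, whose product with itself is only its
  length. The alternative of equality covers this case together with the boundary points.\<close>

lemma bord_reps_close:
  assumes "p \<in> bord" "x \<in> p" "y \<in> p"
  shows "\<exists>N. \<forall>i\<ge>N. \<forall>j\<ge>N. x i = y j \<or> r \<le> gp (x i) (y j)"
proof (cases "p \<in> bdry")
  case True
  then show ?thesis using bdry_reps_close[OF _ assms(2,3), of r] by blast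
next
  case False
  then show ?thesis using assms by (auto simp: bordification_def group_point_def)
qed

text \<open>Up to an additive constant, \<open>near r p q\<close> says that the extended Gromov product of \<open>p\<close> and \<open>q\<close>
  is at least \<open>r\<close>.\<close>

definition near :: "real \<Rightarrow> 'a bpoint \<Rightarrow> 'a bpoint \<Rightarrow> bool" where
  "near r p q \<longleftrightarrow> (\<exists>x\<in>p. \<exists>y\<in>q. \<exists>N. \<forall>i\<ge>N. \<forall>j\<ge>N. r \<le> gp (x i) (y j))"

lemma near_antimono: "near r p q \<Longrightarrow> s \<le> r \<Longrightarrow> near s p q"
  unfolding near_def by (meson order_trans)

lemma near_sym:
  assumes "p \<in> bord" "q \<in> bord" "near r p q"
  shows "near r q p"
proof -
  obtain x y N where x: "x \<in> p" and y: "y \<in> q"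
    and N: "\<And>i j. i \<ge> N \<Longrightarrow> j \<ge> N \<Longrightarrow> r \<le> gp (x i) (y j)"
    using assms(3) unfolding near_def by blast
  have "r \<le> gp (y i) (x j)" if "i \<ge> N" "j \<ge> N" for i j
    using N[OF that(2,1)] gp_commute[OF bord_carrier[OF assms(1) x] bord_carrier[OF assms(2) y], of j i]
    by simp
  then show ?thesis unfolding near_def using x y by blast
qed

lemma near_refl:
  assumes "p \<in> bdry"
  shows "near r p p"
proof -
  obtain x where "x \<in> p" using bord_ex_rep[OF subsetD[OF bdry_subset_bord assms]] ..
  then show ?thesis using bdry_reps_close[OF assms, of x x r] unfolding near_def by auto
qed

text \<open>Replacing the witnessing representative by a given one costs \<delta> on each
  side.\<close>

lemma near_reps:
  assumes "p \<in> bord" "q \<in> bord" "near r p q" "x \<in> p" "y \<in> q"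
  shows "\<exists>N. \<forall>i\<ge>N. \<forall>j\<ge>N. r - 2 * \<delta> \<le> gp (x i) (y j)"
proof -
  obtain x' y' N where x': "x' \<in> p" and y': "y' \<in> q"
    and N: "\<And>i j. i \<ge> N \<Longrightarrow> j \<ge> N \<Longrightarrow> r \<le> gp (x' i) (y' j)"
    using assms(3) unfolding near_def by blast
  obtain M where M: "\<And>i j. i \<ge> M \<Longrightarrow> j \<ge> M \<Longrightarrow> x i = x' j \<or> r \<le> gp (x i) (x' j)"
    using bord_reps_close[OF assms(1,4) x'] by blast
  obtain L where L: "\<And>i j. i \<ge> L \<Longrightarrow> j \<ge> L \<Longrightarrow> y' i = y j \<or> r \<le> gp (y' i) (y j)"
    using bord_reps_close[OF assms(2) y' assms(5)] by blast
  have c: "x i \<in> carrier G" "x' i \<in> carrier G" "y i \<in> carrier G" "y' i \<in> carrier G" for i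
    using bord_carrier[OF assms(1) x'] bord_carrier[OF assms(2) y'] bord_carrier[OF assms(1,4)]
      bord_carrier[OF assms(2,5)] by auto
  define K where "K = max N (max M L)"
  have "r - 2 * \<delta> \<le> gp (x i) (y j)" if "i \<ge> K" "j \<ge> K" for i j
  proof -
    have a: "r - \<delta> \<le> gp (x i) (y' K)"
    proof (cases "x i = x' K")
      case True
      then show ?thesis using N[of K K] delta_nonneg unfolding K_def by simp
    next
      case False
      then have "r \<le> gp (x i) (x' K)" using M[of i K] that unfolding K_def by auto
      moreover have "r \<le> gp (x' K) (y' K)" using N[of K K] unfolding K_def by simp
      ultimately show ?thesis by (rule gp_triangle_ge[OF c(1,2,4)])
    qed
    show ?thesis
    proof (cases "y' K = y j")
      case True
      then show ?thesis using a delta_nonneg by simp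
    next
      case False
      then have "r - \<delta> \<le> gp (y' K) (y j)"
        using L[of K j] that delta_nonneg by (fastforce simp: K_def)
      from gp_triangle_ge[OF c(1,4,3) a this] show ?thesis by linarith
    qed
  qed
  then show ?thesis by blast
qed

text \<open>Of the loss, 2\<delta> comes from passing to a common representative of \<open>q\<close>
  through \<open>near_reps\<close>, and one \<delta> from the hyperbolic inequality.\<close>

lemma near_trans:
  assumes "p \<in> bord" "q \<in> bord" "s \<in> bord" "near r p q" "near r q s"
  shows "near (r - 3 * \<delta>) p s"
proof -
  obtain x y z where xyz: "x \<in> p" "y \<in> q" "z \<in> s"
    using bord_ex_rep[OF assms(1)] bord_ex_rep[OF assms(2)] bord_ex_rep[OF assms(3)] by blast
  obtain N where N: "\<And>i j. i \<ge> N \<Longrightarrow> j \<ge> N \<Longrightarrow> r - 2 * \<delta> \<le> gp (x i) (y j)"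
    using near_reps[OF assms(1,2,4) xyz(1,2)] by blast
  obtain M where M: "\<And>i j. i \<ge> M \<Longrightarrow> j \<ge> M \<Longrightarrow> r - 2 * \<delta> \<le> gp (y i) (z j)"
    using near_reps[OF assms(2,3,5) xyz(2,3)] by blast
  have c: "x i \<in> carrier G" "y i \<in> carrier G" "z i \<in> carrier G" for i
    using bord_carrier[OF assms(1) xyz(1)] bord_carrier[OF assms(2) xyz(2)]
      bord_carrier[OF assms(3) xyz(3)] by auto
  have "r - 3 * \<delta> \<le> gp (x i) (z j)" if "i \<ge> max N M" "j \<ge> max N M" for i j
  proof -
    have "r - 2 * \<delta> \<le> gp (x i) (y (max N M))" "r - 2 * \<delta> \<le> gp (y (max N M)) (z j)"
      using N M that by simp_all
    from gp_triangle_ge[OF c(1,2,3) this] show ?thesis by linarith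
  qed
  then show ?thesis unfolding near_def using xyz by blast
qed

lemma near_all_eq:
  assumes "p \<in> bdry" "q \<in> bdry" "\<And>r. near r p q"
  shows "p = q"
proof -
  have b: "p \<in> bord" "q \<in> bord" using assms(1,2) bdry_subset_bord by auto
  obtain x y where x: "x \<in> p" and y: "y \<in> q" using bord_ex_rep[OF b(1)] bord_ex_rep[OF b(2)] by blast
  have "\<exists>N. \<forall>i\<ge>N. \<forall>j\<ge>N. r \<le> gp (x i) (y j)" for r
    using near_reps[OF b assms(3)[of "r + 2 * \<delta>"] x y] by simp
  then have "(x, y) \<in> seqs_equiv G S"
    using bdry_rep(1) assms x y by (simp add: seqs_equiv_iff)
  then have "seqs_equiv G S `` {x} = seqs_equiv G S `` {y}"
    by (rule equiv_class_eq[OF equiv_seqs_equiv])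
  then show ?thesis using bdry_rep(2) assms x y by blast
qed

section \<open>Nearness under left translation\<close>

lemma near_group_point:
  "near r (group_point g) (group_point h) \<longleftrightarrow> r \<le> gp g h"
  by (auto simp: near_def group_point_def)

lemma act_group_point: "act g (group_point h) = group_point (g \<otimes> h)"
  by (simp add: boundary_act_def group_point_def)

lemma act_one:
  assumes "p \<in> bord"
  shows "act \<one> p = p"
proof -
  have "(\<lambda>i. \<one> \<otimes> x i) = x" if "x \<in> p" for x
    using bord_carrier[OF assms that] by simp
  then show ?thesis unfolding boundary_act_def by simp
qed

lemma act_mult:
  assumes "p \<in> bord" "g \<in> carrier G" "h \<in> carrier G"
  shows "act (g \<otimes> h) p = act g (act h p)"
proof -
  have "(\<lambda>i. g \<otimes> h \<otimes> x i) = (\<lambda>i. g \<otimes> (h \<otimes> x i))" if "x \<in> p" for x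
    using bord_carrier[OF assms(1) that] assms(2,3) by (simp add: m_assoc)
  then show ?thesis unfolding boundary_act_def image_image by simp
qed

lemma inv_mult_cancel:
  assumes "g \<in> carrier G" "x \<in> carrier G"
  shows "inv g \<otimes> (g \<otimes> x) = x" "g \<otimes> (inv g \<otimes> x) = x"
  using assms by (simp_all add: m_assoc[symmetric])

lemma seqs_equiv_translate:
  assumes "(x, y) \<in> seqs_equiv G S" "g \<in> carrier G"
  shows "((\<lambda>i. g \<otimes> x i), (\<lambda>i. g \<otimes> y i)) \<in> seqs_equiv G S"
proof -
  have *: "\<exists>N. \<forall>i\<ge>N. \<forall>j\<ge>N. r \<le> gp (g \<otimes> x i) (g \<otimes> y j)"
    if xy: "range x \<subseteq> carrier G" "range y \<subseteq> carrier G" 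
      "\<forall>r. \<exists>N. \<forall>i\<ge>N. \<forall>j\<ge>N. r \<le> gp (x i) (y j)" for x y :: "nat \<Rightarrow> 'a" and r
  proof -
    obtain N where N: "\<And>i j. i \<ge> N \<Longrightarrow> j \<ge> N \<Longrightarrow> r + len g \<le> gp (x i) (y j)"
      using xy(3) by meson
    have "r \<le> gp (g \<otimes> x i) (g \<otimes> y j)" if "i \<ge> N" "j \<ge> N" for i j
      using N[OF that] gp_translate[OF assms(2), of "x i" "y j"] xy(1,2) by (simp add: range_subsetD)
    then show ?thesis by blast
  qed
  have xy: "range x \<subseteq> carrier G" "range y \<subseteq> carrier G"
    "\<forall>r. \<exists>N. \<forall>i\<ge>N. \<forall>j\<ge>N. r \<le> gp (x i) (x j)" "\<forall>r. \<exists>N. \<forall>i\<ge>N. \<forall>j\<ge>N. r \<le> gp (y i) (y j)"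
    "\<forall>r. \<exists>N. \<forall>i\<ge>N. \<forall>j\<ge>N. r \<le> gp (x i) (y j)"
    using assms(1) by (simp_all add: seqs_equiv_iff seqs_to_infinity_iff)
  have "range (\<lambda>i. g \<otimes> x i) \<subseteq> carrier G" "range (\<lambda>i. g \<otimes> y i) \<subseteq> carrier G"
    using xy(1,2) assms(2) by blast+
  then show ?thesis
    using *[OF xy(1,1,3)] *[OF xy(2,2,4)] *[OF xy(1,2,5)]
    unfolding seqs_equiv_iff seqs_to_infinity_iff by simp
qed

lemma act_bdry:
  assumes "p \<in> bdry" "g \<in> carrier G"
  shows "act g p \<in> bdry"
proof -
  obtain x where x: "x \<in> p" using bord_ex_rep[OF subsetD[OF bdry_subset_bord assms(1)]] by blast
  let ?gx = "\<lambda>i. g \<otimes> x i"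
  have p: "p = seqs_equiv G S `` {x}" "x \<in> seqs_to_infinity G S" using bdry_rep assms x by auto
  have "(x, x) \<in> seqs_equiv G S" using x p(1) by (metis Image_singleton_iff)
  from seqs_equiv_translate[OF this assms(2)] have gx: "?gx \<in> seqs_to_infinity G S"
    unfolding seqs_equiv_iff by (rule conjunct1)
  have "act g p = seqs_equiv G S `` {?gx}"
  proof
    show "act g p \<subseteq> seqs_equiv G S `` {?gx}"
    proof
      fix z assume "z \<in> act g p"
      then obtain y where "z = (\<lambda>i. g \<otimes> y i)" "y \<in> p" unfolding boundary_act_def by blast
      then show "z \<in> seqs_equiv G S `` {?gx}"
        using seqs_equiv_translate[OF _ assms(2), of x y] p(1) by (metis Image_singleton_iff)
    qed
    show "seqs_equiv G S `` {?gx} \<subseteq> act g p"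
    proof
      fix z assume "z \<in> seqs_equiv G S `` {?gx}"
      then have z: "(?gx, z) \<in> seqs_equiv G S" by simp
      then have zc: "z i \<in> carrier G" for i by (auto simp: seqs_equiv_iff seqs_to_infinity_iff)
      have xc: "x i \<in> carrier G" for i using p(2) by (auto simp: seqs_to_infinity_iff)
      have "(\<lambda>i. inv g \<otimes> (g \<otimes> x i), \<lambda>i. inv g \<otimes> z i) \<in> seqs_equiv G S"
        by (rule seqs_equiv_translate[OF z]) (use assms(2) in simp)
      then have "(x, \<lambda>i. inv g \<otimes> z i) \<in> seqs_equiv G S"
        by (simp only: inv_mult_cancel(1)[OF assms(2) xc])
      then have "(\<lambda>i. inv g \<otimes> z i) \<in> p" unfolding p(1) by blast
      then have "(\<lambda>i. g \<otimes> (inv g \<otimes> z i)) \<in> act g p"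
        unfolding boundary_act_def by (rule rev_image_eqI) (rule refl)
      then show "z \<in> act g p"
        by (simp only: inv_mult_cancel(2)[OF assms(2) zc])
    qed
  qed
  then show ?thesis by (simp only: bdryI[OF gx])
qed

lemma act_bord: "p \<in> bord \<Longrightarrow> g \<in> carrier G \<Longrightarrow> act g p \<in> bord"
  using act_bdry by (auto simp: bordification_def act_group_point)

lemma act_inv_act:
  assumes "p \<in> bord" "g \<in> carrier G"
  shows "act (inv g) (act g p) = p" "act g (act (inv g) p) = p"
proof -
  have "act (inv g \<otimes> g) p = act (inv g) (act g p)" "act (g \<otimes> inv g) p = act g (act (inv g) p)"
    by (simp_all only: act_mult assms inv_closed)
  then show "act (inv g) (act g p) = p" "act g (act (inv g) p) = p"
    using act_one[OF assms(1)] assms(2) by simp_all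
qed

lemma near_act:
  assumes "p \<in> bord" "q \<in> bord" "g \<in> carrier G" "near r p q"
  shows "near (r - real (len g)) (act g p) (act g q)"
proof -
  obtain x y N where x: "x \<in> p" and y: "y \<in> q"
    and N: "\<And>i j. i \<ge> N \<Longrightarrow> j \<ge> N \<Longrightarrow> r \<le> gp (x i) (y j)"
    using assms(4) unfolding near_def by blast
  have c: "x i \<in> carrier G" "y i \<in> carrier G" for i
    using bord_carrier[OF assms(1) x] bord_carrier[OF assms(2) y] by auto
  have "r - len g \<le> gp (g \<otimes> x i) (g \<otimes> y j)" if "i \<ge> N" "j \<ge> N" for i j
    using N[OF that] gp_translate[OF assms(3) c(1,2), of i j] by simp
  then show ?thesis
    unfolding near_def boundary_act_def
    by (intro bexI[OF _ imageI[OF x]] bexI[OF _ imageI[OF y]] exI[of _ N]) simp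
qed

lemma near_group_pointI:
  assumes "x \<in> p" "\<And>j. j \<ge> N \<Longrightarrow> r \<le> gp g (x j)"
  shows "near r (group_point g) p"
  unfolding near_def group_point_def
  by (intro bexI[of _ "\<lambda>_. g"] bexI[OF _ assms(1)] exI[of _ N]) (use assms(2) in auto)

lemma near_group_pointD:
  assumes "p \<in> bord" "g \<in> carrier G" "near r (group_point g) p" "x \<in> p"
  obtains N where "\<And>j. j \<ge> N \<Longrightarrow> r - 2 * \<delta> \<le> gp g (x j)"
proof -
  have "(\<lambda>_. g) \<in> group_point g" by (simp add: group_point_def)
  then obtain N where "\<forall>i\<ge>N. \<forall>j\<ge>N. r - 2 * \<delta> \<le> gp g (x j)"
    using near_reps[OF group_point_bord[OF assms(2)] assms(1,3) _ assms(4)] by blast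
  then show thesis using that by blast
qed

text \<open>By \<open>gp_inverse_sum\<close>, a small product of \<open>inv g\<close> with the
  representatives of \<open>p\<close> forces a product of \<open>g\<close> with their translates
  close to \<open>len g\<close>.\<close>

lemma near_group_point_act:
  assumes "p \<in> bdry" "g \<in> carrier G" "\<not> near r (group_point (inv g)) p"
  shows "near (real (len g) - r - \<delta>) (group_point g) (act g p)"
proof -
  have b: "p \<in> bord" using assms(1) bdry_subset_bord by blast
  obtain x where x: "x \<in> p" using bord_ex_rep[OF b] by blast
  have c: "x i \<in> carrier G" for i using bord_carrier[OF b x] by blast
  obtain N where N: "\<And>i j. i \<ge> N \<Longrightarrow> j \<ge> N \<Longrightarrow> r + \<delta> \<le> gp (x i) (x j)"
    using bdry_reps_close[OF assms(1) x x] by blast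
  \<comment> \<open>Failure of \<open>near\<close> excludes only a bound on a whole tail. One large
    product at a late index would spread to the tail at the cost of \<delta>, so every late product
    is bounded.\<close>
  have "gp (inv g) (x i) < r + \<delta>" if i: "i \<ge> N" for i
  proof (rule ccontr)
    assume "\<not> gp (inv g) (x i) < r + \<delta>"
    then have "r \<le> gp (inv g) (x j)" if "j \<ge> N" for j
      using gp_triangle_ge[of "inv g" "x i" "x j" "r + \<delta>"] N[OF i that] c assms(2) by simp
    then have "near r (group_point (inv g)) p" by (rule near_group_pointI[OF x])
    with assms(3) show False by blast
  qed
  then have "real (len g) - r - \<delta> \<le> gp g (g \<otimes> x i)" if "i \<ge> N" for i
    using gp_inverse_sum[OF assms(2) c[of i]] that by fastforce
  moreover have "(\<lambda>i. g \<otimes> x i) \<in> act g p" using x by (simp add: boundary_act_def)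
  ultimately show ?thesis by (intro near_group_pointI)
qed

text \<open>Seen from a point \<open>g\<close> close to the ray to \<open>p\<close>, the identity
  and \<open>p\<close> lie in different directions. The two assumptions lose 2\<delta> each when
  read on the representative \<open>x\<close>, and the 1 makes the sum of the products exceed
  \<open>len g\<close>.\<close>

lemma not_near_group_point_act:
  assumes "p \<in> bdry" "g \<in> carrier G" "near (real (len g) - r) (group_point g) p"
  shows "\<not> near (r + 4 * \<delta> + 1) (group_point (inv g)) (act (inv g) p)"
proof
  assume n: "near (r + 4 * \<delta> + 1) (group_point (inv g)) (act (inv g) p)"
  have b: "p \<in> bord" using assms(1) bdry_subset_bord by blast
  obtain x where x: "x \<in> p" using bord_ex_rep[OF b] by blast
  have c: "x i \<in> carrier G" for i using bord_carrier[OF b x] by blast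
  obtain N where N: "\<And>j. j \<ge> N \<Longrightarrow> real (len g) - r - 2 * \<delta> \<le> gp g (x j)"
    using near_group_pointD[OF b assms(2,3) x] by blast
  have "(\<lambda>i. inv g \<otimes> x i) \<in> act (inv g) p" using x by (simp add: boundary_act_def)
  then obtain M where M: "\<And>j. j \<ge> M \<Longrightarrow>
      r + 4 * \<delta> + 1 - 2 * \<delta> \<le> gp (inv g) (inv g \<otimes> x j)"
    using near_group_pointD[OF act_bord[OF b] _ n] assms(2) by (metis inv_closed)
  have "gp (inv g) (inv g \<otimes> x (max N M)) + gp g (x (max N M)) = real (len g)"
    using gp_inverse_sum[of "inv g" "x (max N M)"] assms(2) c len_inv by simp
  then show False using N[of "max N M"] M[of "max N M"] by simp
qed

section \<open>Nearness compared with the topology of the bordification\<close>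

lemma near_of_ext_gromov_product:
  assumes "ereal r < ext_gromov_product G S p q"
  shows "near r p q"
proof -
  obtain x y where "x \<in> p" "y \<in> q"
    and "ereal r < Liminf (sequentially \<times>\<^sub>F sequentially) (\<lambda>(i, j). ereal (gp (x i) (y j)))"
    using assms unfolding ext_gromov_product_def less_SUP_iff by blast
  then have "\<forall>\<^sub>F z in sequentially \<times>\<^sub>F sequentially. ereal r < (\<lambda>(i, j). ereal (gp (x i) (y j))) z"
    using less_LiminfD by blast
  then have "\<exists>N. \<forall>i\<ge>N. \<forall>j\<ge>N. r < gp (x j) (y i)"
    unfolding eventually_prod_sequentially by simp
  then have "\<exists>N. \<forall>i\<ge>N. \<forall>j\<ge>N. r \<le> gp (x i) (y j)" by (meson less_imp_le)
  then show ?thesis unfolding near_def using \<open>x \<in> p\<close> \<open>y \<in> q\<close> by blast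
qed

lemma ext_gromov_product_of_near:
  assumes "near r p q"
  shows "ereal r \<le> ext_gromov_product G S p q"
proof -
  obtain x y N where x: "x \<in> p" and y: "y \<in> q"
    and N: "\<And>i j. i \<ge> N \<Longrightarrow> j \<ge> N \<Longrightarrow> r \<le> gp (x i) (y j)"
    using assms unfolding near_def by blast
  have "ereal r \<le> Liminf (sequentially \<times>\<^sub>F sequentially) (\<lambda>(i, j). ereal (gp (x i) (y j)))"
    by (rule Liminf_bounded) (use N in \<open>auto simp: eventually_prod_sequentially\<close>)
  also have "\<dots> \<le> ext_gromov_product G S p q"
    unfolding ext_gromov_product_def using x y by (blast intro: SUP_upper2)
  finally show ?thesis .
qed

lemma openin_bord_near:
  assumes "openin (bordification_topology G S) U" "p \<in> U" "p \<in> bdry"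
  shows "\<exists>r. \<forall>q\<in>bord. near r p q \<longrightarrow> q \<in> U"
proof -
  obtain r :: real where r: "{q \<in> bord. ereal r < ext_gromov_product G S p q} \<subseteq> U"
    using assms unfolding openin_bordification_topology by blast
  \<comment> \<open>Nearness yields a weak inequality for the extended product; the extra 1 makes it
    strict.\<close>
  have "q \<in> U" if "q \<in> bord" "near (r + 1) p q" for q
  proof -
    have "ereal r < ereal (r + 1)" by simp
    also have "\<dots> \<le> ext_gromov_product G S p q" by (rule ext_gromov_product_of_near[OF that(2)])
    finally show ?thesis using r that(1) by blast
  qed
  then show ?thesis by blast
qed

text \<open>Being coarse, the set of points near \<open>p\<close> need not be open. \<open>U\<close>
  is its interior written by hand: boundary points are kept only if a whole neighbourhood is near
  \<open>p\<close>. A neighbourhood smaller by 3\<delta> stays in \<open>U\<close> by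
  \<open>near_trans\<close>.\<close>

lemma near_openin_bord:
  assumes "p \<in> bdry"
  shows "\<exists>U. openin (bordification_topology G S) U \<and> p \<in> U \<and> (\<forall>q\<in>U. near r p q)"
proof -
  define U where "U = {q \<in> bord. near r p q \<and>
    (q \<in> bdry \<longrightarrow> (\<exists>s. \<forall>q'\<in>bord. near s q q' \<longrightarrow> near r p q'))}"
  have "openin (bordification_topology G S) U"
    unfolding openin_bordification_topology
  proof (intro conjI ballI)
    show "U \<subseteq> bord" unfolding U_def by blast
    fix q assume q: "q \<in> U \<inter> bdry"
    then obtain s where s: "\<And>q'. q' \<in> bord \<Longrightarrow> near s q q' \<Longrightarrow> near r p q'"
      unfolding U_def by blast
    have qb: "q \<in> bord" using q bdry_subset_bord by blast
    have "q' \<in> U" if q': "q' \<in> bord" "near (s + 3 * \<delta>) q q'" for q'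
    proof -
      have "near r p q'" using s q' near_antimono delta_nonneg by simp
      moreover have "near r p q''" if "q'' \<in> bord" "near (s + 3 * \<delta>) q' q''" for q''
        using near_trans[OF qb q'(1) that(1) q'(2) that(2)] s that(1) by simp
      ultimately show ?thesis unfolding U_def using q'(1) by blast
    qed
    then show "\<exists>r. {q' \<in> bord. ereal r < ext_gromov_product G S q q'} \<subseteq> U"
      using near_of_ext_gromov_product by blast
  qed
  moreover have "p \<in> U"
    using assms near_refl bdry_subset_bord unfolding U_def by blast
  ultimately show ?thesis unfolding U_def by blast
qed

lemma openin_boundary_near:
  assumes "openin (boundary_topology G S) U" "p \<in> U"
  shows "\<exists>r. \<forall>q\<in>bdry. near r p q \<longrightarrow> q \<in> U"
proof -
  obtain T where "openin (bordification_topology G S) T" "U = T \<inter> bdry"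
    using assms(1) unfolding boundary_topology_def openin_subtopology by blast
  then show ?thesis using openin_bord_near[of T p] assms(2) bdry_subset_bord by blast
qed

lemma closedin_boundary_not_near:
  assumes "closedin (boundary_topology G S) K" "p \<in> bdry" "p \<notin> K"
  shows "\<exists>r. \<forall>q\<in>K. \<not> near r p q"
proof -
  have "openin (boundary_topology G S) (bdry - K)" "K \<subseteq> bdry"
    using assms(1) unfolding closedin_def by auto
  moreover have "p \<in> bdry - K" using assms(2,3) by simp
  ultimately obtain r where "\<forall>q\<in>bdry. near r p q \<longrightarrow> q \<in> bdry - K"
    using openin_boundary_near by presburger
  then have "\<forall>q\<in>K. \<not> near r p q" using \<open>K \<subseteq> bdry\<close> by auto
  then show ?thesis ..
qed

text \<open>For a boundary point \<open>p\<close> and a sequence in the bordification this amounts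
  to topological convergence, stated without open sets.\<close>

definition tends_to :: "(nat \<Rightarrow> 'a bpoint) \<Rightarrow> 'a bpoint \<Rightarrow> bool" where
  "tends_to x p \<longleftrightarrow> (\<forall>r. \<forall>\<^sub>F n in sequentially. near r p (x n))"

lemma tends_to_limitin:
  assumes "tends_to x p" "p \<in> bdry" "range x \<subseteq> bdry"
  shows "limitin (boundary_topology G S) x p sequentially"
  unfolding limitin_def
proof (intro conjI allI impI)
  show "p \<in> topspace (boundary_topology G S)" using assms by simp
  fix U assume U: "openin (boundary_topology G S) U \<and> p \<in> U"
  then obtain r where r: "\<forall>q\<in>bdry. near r p q \<longrightarrow> q \<in> U" using openin_boundary_near by blast
  have "\<forall>\<^sub>F n in sequentially. near r p (x n)" using assms(1) unfolding tends_to_def by blast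
  then show "\<forall>\<^sub>F n in sequentially. x n \<in> U"
    by eventually_elim (use r assms(3) in blast)
qed

lemma tends_to_filterlim:
  "tends_to x p \<Longrightarrow> filterlim \<phi> sequentially sequentially \<Longrightarrow> tends_to (\<lambda>n. x (\<phi> n)) p"
  unfolding tends_to_def by (intro allI eventually_compose_filterlim[of _ sequentially \<phi>]) simp_all

lemma near_both_eq:
  assumes "p \<in> bdry" "q \<in> bdry" "\<And>r. \<exists>s\<in>bord. near r p s \<and> near r q s"
  shows "p = q"
proof (rule near_all_eq[OF assms(1,2)])
  fix r
  have b: "p \<in> bord" "q \<in> bord" using assms(1,2) bdry_subset_bord by auto
  obtain s where "s \<in> bord" "near (r + 3 * \<delta>) p s" "near (r + 3 * \<delta>) q s"
    using assms(3) by blast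
  then show "near r p q"
    using near_trans[of p s q "r + 3 * \<delta>"] near_sym[of q s "r + 3 * \<delta>"] b by simp
qed

lemma group_point_not_bdry: "g \<in> carrier G \<Longrightarrow> group_point g \<notin> bdry"
proof
  assume g: "g \<in> carrier G" and "group_point g \<in> bdry"
  moreover have "(\<lambda>_. g) \<in> group_point g" by (simp add: group_point_def)
  ultimately have "\<exists>N. \<forall>i\<ge>N. \<forall>j\<ge>N. real (len g) + 1 \<le> gp ((\<lambda>_::nat. g) i) ((\<lambda>_::nat. g) j)"
    by (intro bdry_reps_close[of "group_point g"])
  then show False using gp_self[OF g] by auto
qed

text \<open>A derived set asks for points other than \<open>p\<close>; this is automatic here, as
  \<open>group_point h\<close> is never a boundary point.\<close>

lemma limit_set_iff:
  assumes "H \<subseteq> carrier G"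
  shows "p \<in> limit_set G S H \<longleftrightarrow> p \<in> bdry \<and> (\<forall>r. \<exists>h\<in>H. near r p (group_point h))"
proof (intro iffI conjI allI)
  assume p: "p \<in> limit_set G S H"
  then show pb: "p \<in> bdry" by (simp add: limit_set_def)
  fix r
  obtain U where U: "openin (bordification_topology G S) U" "p \<in> U" "\<forall>q\<in>U. near r p q"
    using near_openin_bord[OF pb, of r] by meson
  have "\<forall>T. p \<in> T \<and> openin (bordification_topology G S) T \<longrightarrow> (\<exists>y. y \<noteq> p \<and> y \<in> group_point ` H \<and> y \<in> T)"
    using p by (simp add: limit_set_def derived_set_of_def)
  then obtain y where "y \<in> group_point ` H" "y \<in> U" using U by meson
  then show "\<exists>h\<in>H. near r p (group_point h)" using U(3) by auto
next
  assume p: "p \<in> bdry \<and> (\<forall>r. \<exists>h\<in>H. near r p (group_point h))"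
  have "\<exists>y. y \<noteq> p \<and> y \<in> group_point ` H \<and> y \<in> T"
    if T: "p \<in> T" "openin (bordification_topology G S) T" for T
  proof -
    obtain r where r: "\<And>q. q \<in> bord \<Longrightarrow> near r p q \<Longrightarrow> q \<in> T"
      using openin_bord_near[OF T(2,1)] p by meson
    obtain h where h: "h \<in> H" "near r p (group_point h)" using p by meson
    have hG: "h \<in> carrier G" using h(1) assms by (rule subsetD[rotated])
    have "group_point h \<in> T" using r[OF group_point_bord[OF hG] h(2)] .
    moreover have "group_point h \<noteq> p" using group_point_not_bdry[OF hG] p by metis
    ultimately show ?thesis using h(1) by (metis imageI)
  qed
  then show "p \<in> limit_set G S H"
    using p bdry_subset_bord unfolding limit_set_def derived_set_of_def by auto
qed

end

section \<open>Compactness and convergence dynamics\<close>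

lemma ex_constant_subseq:
  fixes f :: "nat \<Rightarrow> 'b"
  assumes "finite (range f)"
  obtains c and r :: "nat \<Rightarrow> nat" where "strict_mono r" "\<And>i. f (r i) = c"
proof -
  obtain m where "infinite {n \<in> UNIV. f n = f m}"
    using pigeonhole_infinite[of "UNIV :: nat set" f] assms by auto
  then obtain r :: "nat \<Rightarrow> nat" where "strict_mono r" "\<forall>i. r i \<in> {n \<in> UNIV. f n = f m}"
    using infinite_enumerate by metis
  then show thesis using that[of r "f m"] by simp
qed

lemma filterlim_at_top_nat_ge:
  fixes f :: "nat \<Rightarrow> nat"
  assumes "\<And>n. n \<le> f n"
  shows "filterlim f at_top sequentially"
  unfolding filterlim_at_top eventually_sequentially by (meson assms order_trans)

context hyperbolic_group_const
begin

section \<open>Sequential compactness\<close>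

lemma ex_prefix:
  assumes "g \<in> carrier G" "k \<le> len g"
  shows "\<exists>h. h \<in> carrier G \<and> len h = k \<and> gp h g = real k"
proof -
  obtain h where "h \<in> carrier G" "len h = k" "len (inv h \<otimes> g) = len g - k"
    using len_prefix assms by blast
  then show ?thesis using gp_prefix[of g h] assms by auto
qed

text \<open>Balls are finite, so a diagonal subsequence makes the prefix of each length
  \<open>k\<close> constant from some index on. Elements sharing a prefix of length \<open>k\<close>
  have product at least \<open>k\<close> - \<delta>, hence the subsequence converges to infinity and
  defines \<open>p\<close>.\<close>

lemma group_seq_compact:
  assumes g: "range g \<subseteq> carrier G" and lim: "filterlim (\<lambda>n. len (g n)) at_top sequentially"
  obtains p and \<phi> :: "nat \<Rightarrow> nat" where "p \<in> bdry" "strict_mono \<phi>" "tends_to (\<lambda>n. group_point (g (\<phi> n))) p"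
proof -
  have gc: "g n \<in> carrier G" for n using g by blast
  \<comment> \<open>The value \<open>\<one>\<close> for elements shorter than \<open>k\<close> keeps
    \<open>pre k\<close> inside the finite ball of radius \<open>k\<close>; along the sequence this
    case dies out.\<close>
  define pre where "pre k x =
    (if k \<le> len x then SOME h. h \<in> carrier G \<and> len h = k \<and> gp h x = real k else \<one>)" for k x
  have pre: "pre k x \<in> carrier G \<and> len (pre k x) = k \<and> gp (pre k x) x = real k"
    if "x \<in> carrier G" "k \<le> len x" for k x
    using someI_ex[OF ex_prefix[OF that]] that(2) unfolding pre_def by simp
  have pre_ball: "pre k (g n) \<in> {h \<in> carrier G. len h \<le> k}" for k n
  proof (cases "k \<le> len (g n)")
    case True
    then show ?thesis using pre[OF gc] by auto
  next
    case False
    then show ?thesis by (simp add: pre_def len_one)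
  qed
  interpret subseqs "\<lambda>k s. \<exists>c. \<forall>i. pre k (g (s i)) = c"
  proof
    fix k and s :: "nat \<Rightarrow> nat" assume "strict_mono s"
    have "finite (range (\<lambda>i. pre k (g (s i))))"
      by (rule finite_subset[OF _ finite_ball[of k]]) (use pre_ball in blast)
    then obtain c and r :: "nat \<Rightarrow> nat" where "strict_mono r" "\<And>i. pre k (g (s (r i))) = c"
      by (rule ex_constant_subseq) blast
    then have r: "strict_mono r" "\<exists>c. \<forall>i. pre k (g ((s \<circ> r) i)) = c" by simp_all
    show "\<exists>r :: nat \<Rightarrow> nat. strict_mono r \<and> (\<exists>c. \<forall>i. pre k (g ((s \<circ> r) i)) = c)"
      by (intro exI[of _ r] conjI r)
  qed
  define x where "x n = g (diagseq n)" for n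
  have xc: "x n \<in> carrier G" for n using gc by (simp add: x_def)
  \<comment> \<open>From index \<open>Suc k\<close> on, the diagonal sequence is a subsequence of
    the one chosen at stage \<open>k\<close>.\<close>
  have tail: "\<exists>c. \<forall>i. pre k (g ((diagseq \<circ> (+) (Suc k)) i)) = c" for k
    by (rule diagseq_holds) auto
  have "\<exists>N. \<forall>i\<ge>N. \<forall>j\<ge>N. r \<le> gp (x i) (x j)" for r
  proof -
    define k where "k = nat \<lceil>r + \<delta>\<rceil>"
    have k: "r + \<delta> \<le> real k" unfolding k_def by linarith
    obtain c where c: "\<And>i. pre k (g (diagseq (Suc k + i))) = c" using tail[of k] by auto
    obtain N where N: "\<And>n. n \<ge> N \<Longrightarrow> k \<le> len (g n)"
      using lim unfolding filterlim_at_top eventually_sequentially by meson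
    have *: "c \<in> carrier G \<and> gp c (x i) = real k" if "i \<ge> max N (Suc k)" for i
    proof -
      have "N \<le> diagseq i" using that seq_suble[OF subseq_diagseq, of i] by linarith
      then have "k \<le> len (x i)" unfolding x_def by (rule N)
      moreover have "pre k (x i) = c" using c[of "i - Suc k"] that by (simp add: x_def)
      ultimately show ?thesis using pre[OF xc, of k i] by simp
    qed
    have "r \<le> gp (x i) (x j)" if i: "i \<ge> max N (Suc k)" and j: "j \<ge> max N (Suc k)" for i j
    proof -
      have "c \<in> carrier G" using *[OF i] ..
      moreover have "real k \<le> gp (x i) c" using *[OF i] gp_commute[OF xc, of c i] by simp
      moreover have "real k \<le> gp c (x j)" using *[OF j] by simp
      ultimately have "real k - \<delta> \<le> gp (x i) (x j)" by (intro gp_triangle_ge[OF xc _ xc])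
      then show ?thesis using k by linarith
    qed
    then show ?thesis by meson
  qed
  then have x: "x \<in> seqs_to_infinity G S"
    unfolding seqs_to_infinity_iff using xc by auto
  define p where "p = seqs_equiv G S `` {x}"
  have pb: "p \<in> bdry" unfolding p_def by (rule bdryI[OF x])
  have xp: "x \<in> p" unfolding p_def using equiv_class_self[OF equiv_seqs_equiv x] .
  have "tends_to (\<lambda>n. group_point (x n)) p"
    unfolding tends_to_def eventually_sequentially
  proof
    fix r
    obtain N where N: "\<forall>i\<ge>N. \<forall>j\<ge>N. r \<le> gp (x i) (x j)"
      using bdry_reps_close[OF pb xp xp] by meson
    have "near r p (group_point (x n))" if "n \<ge> N" for n
    proof -
      have "near r (group_point (x n)) p" by (rule near_group_pointI[OF xp, of N]) (use N that in simp)
      then show ?thesis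
        by (rule near_sym[OF group_point_bord[OF xc] subsetD[OF bdry_subset_bord pb]])
    qed
    then show "\<exists>N. \<forall>n\<ge>N. near r p (group_point (x n))" by meson
  qed
  then show thesis using that[OF pb subseq_diagseq] unfolding x_def by simp
qed

lemma tends_to_near:
  assumes "tends_to x p" "p \<in> bord" "range x \<subseteq> bord" "range y \<subseteq> bord"
    and "\<And>r. \<forall>\<^sub>F n in sequentially. near r (x n) (y n)"
  shows "tends_to y p"
  unfolding tends_to_def
proof
  fix r
  have "\<forall>\<^sub>F n in sequentially. near (r + 3 * \<delta>) p (x n)"
    using assms(1) unfolding tends_to_def by simp
  moreover note assms(5)[of "r + 3 * \<delta>"]
  ultimately show "\<forall>\<^sub>F n in sequentially. near r p (y n)"
  proof eventually_elim
    case (elim n)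
    have "x n \<in> bord" "y n \<in> bord" using assms(3,4) by auto
    from near_trans[OF assms(2) this elim] show ?case by simp
  qed
qed

lemma bdry_approx:
  assumes "p \<in> bdry"
  shows "\<exists>g. g \<in> carrier G \<and> n \<le> len g \<and> near (real n) (group_point g) p"
proof -
  have b: "p \<in> bord" using assms bdry_subset_bord by blast
  obtain x where x: "x \<in> p" using bord_ex_rep[OF b] ..
  obtain N where N: "\<forall>i\<ge>N. \<forall>j\<ge>N. real n \<le> gp (x i) (x j)"
    using bdry_reps_close[OF assms x x] by meson
  have c: "x N \<in> carrier G" by (rule bord_carrier[OF b x])
  have "near (real n) (group_point (x N)) p"
    by (rule near_group_pointI[OF x, of N]) (use N in simp)
  moreover have "n \<le> len (x N)" using N gp_self[OF c] by force
  ultimately show ?thesis using c by auto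
qed

text \<open>The \<open>n\<close>-th boundary point is replaced by a group element agreeing with it
  to depth \<open>n\<close>, which reduces the claim to sequences in the group.\<close>

lemma bdry_seq_compact:
  fixes x :: "nat \<Rightarrow> 'a bpoint"
  assumes "range x \<subseteq> bdry"
  obtains p and \<phi> :: "nat \<Rightarrow> nat" where "p \<in> bdry" "strict_mono \<phi>" "tends_to (\<lambda>n. x (\<phi> n)) p"
proof -
  have xb: "x n \<in> bdry" for n using assms by blast
  have "\<forall>n. \<exists>g. g \<in> carrier G \<and> n \<le> len g \<and> near (real n) (group_point g) (x n)"
    using bdry_approx[OF xb] by simp
  from choice[OF this] obtain g where "\<forall>n. g n \<in> carrier G \<and> n \<le> len (g n) \<and> near (real n) (group_point (g n)) (x n)"
    ..
  then have g: "\<And>n. g n \<in> carrier G" "\<And>n. n \<le> len (g n)"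
    "\<And>n. near (real n) (group_point (g n)) (x n)"
    by simp_all
  obtain p \<phi> where p: "p \<in> bdry" "strict_mono \<phi>" "tends_to (\<lambda>n. group_point (g (\<phi> n))) p"
    by (rule group_seq_compact[OF _ filterlim_at_top_nat_ge[OF g(2)]]) (use g(1) in auto)
  have "tends_to (\<lambda>n. x (\<phi> n)) p"
  proof (rule tends_to_near[OF p(3)])
    show "p \<in> bord" "range (\<lambda>n. group_point (g (\<phi> n))) \<subseteq> bord" "range (\<lambda>n. x (\<phi> n)) \<subseteq> bord"
      using p(1) xb g(1) group_point_bord bdry_subset_bord by auto
    fix r
    have "near r (group_point (g (\<phi> n))) (x (\<phi> n))" if "n \<ge> nat \<lceil>r\<rceil>" for n
    proof (rule near_antimono[OF g(3)])
      show "r \<le> real (\<phi> n)" using that seq_suble[OF p(2), of n] by linarith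
    qed
    then show "\<forall>\<^sub>F n in sequentially. near r (group_point (g (\<phi> n))) (x (\<phi> n))"
      unfolding eventually_sequentially by meson
  qed
  then show thesis using that p(1,2) by blast
qed

section \<open>Attracting and repelling points of sequences of group elements\<close>

lemma near_group_point_le_len:
  assumes "p \<in> bord" "g \<in> carrier G" "near r p (group_point g)"
  shows "r - 2 * \<delta> \<le> real (len g)"
proof -
  obtain x where x: "x \<in> p" using bord_ex_rep[OF assms(1)] ..
  have "near r (group_point g) p"
    by (rule near_sym[OF assms(1) group_point_bord[OF assms(2)] assms(3)])
  then obtain N where "\<And>j. j \<ge> N \<Longrightarrow> r - 2 * \<delta> \<le> gp g (x j)"
    using near_group_pointD[OF assms(1,2) _ x] by metis
  then have "r - 2 * \<delta> \<le> gp g (x N)" by simp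
  also have "\<dots> \<le> real (len g)" by (rule gp_le_len[OF assms(2) bord_carrier[OF assms(1) x]])
  finally show ?thesis .
qed

lemma tends_to_len:
  assumes "tends_to (\<lambda>n. group_point (g n)) p" "p \<in> bdry" "range g \<subseteq> carrier G"
  shows "\<forall>\<^sub>F n in sequentially. r \<le> real (len (g n))"
proof -
  have "\<forall>\<^sub>F n in sequentially. near (r + 2 * \<delta>) p (group_point (g n))"
    using assms(1) unfolding tends_to_def by simp
  then show ?thesis
  proof eventually_elim
    case (elim n)
    have "g n \<in> carrier G" using assms(3) by blast
    from near_group_point_le_len[OF subsetD[OF bdry_subset_bord assms(2)] this elim]
    show ?case by simp
  qed
qed

text \<open>A point away from \<open>q\<close> is eventually away from \<open>inv (g n)\<close>, so
  \<open>near_group_point_act\<close> puts its image close to \<open>g n\<close>, which is close to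
  \<open>p\<close>. The index depends on \<open>R\<close> and \<open>r\<close> but not on
  \<open>x\<close>.\<close>

lemma convergence_dynamics:
  assumes "range g \<subseteq> carrier G" "p \<in> bdry" "q \<in> bdry"
    and "tends_to (\<lambda>n. group_point (g n)) p" "tends_to (\<lambda>n. group_point (inv (g n))) q"
  shows "\<forall>\<^sub>F n in sequentially. \<forall>x\<in>bdry. \<not> near R q x \<longrightarrow> near r p (act (g n) x)"
proof -
  have b: "p \<in> bord" "q \<in> bord" using assms(2,3) bdry_subset_bord by auto
  have "\<forall>\<^sub>F n in sequentially. near (R + 3 * \<delta>) q (group_point (inv (g n)))"
    using assms(5) unfolding tends_to_def by simp
  moreover have "\<forall>\<^sub>F n in sequentially. near (r + 3 * \<delta>) p (group_point (g n))"
    using assms(4) unfolding tends_to_def by simp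
  \<comment> \<open>Here 7\<delta> = 3\<delta> + \<delta> + 3\<delta>: one \<open>near_trans\<close>
    at \<open>q\<close>, the loss in \<open>near_group_point_act\<close>, and one
    \<open>near_trans\<close> at \<open>p\<close>.\<close>
  moreover have "\<forall>\<^sub>F n in sequentially. r + 7 * \<delta> + R \<le> real (len (g n))"
    by (rule tends_to_len[OF assms(4,2,1)])
  ultimately show ?thesis
  proof eventually_elim
    case (elim n)
    have gn: "g n \<in> carrier G" using assms(1) by blast
    show ?case
    proof (intro ballI impI)
      fix x assume x: "x \<in> bdry" and nx: "\<not> near R q x"
      have xb: "x \<in> bord" using x bdry_subset_bord by blast
      have "\<not> near (R + 3 * \<delta>) (group_point (inv (g n))) x"
      proof
        assume "near (R + 3 * \<delta>) (group_point (inv (g n))) x"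
        from near_trans[OF b(2) group_point_bord[OF inv_closed[OF gn]] xb elim(1) this]
        show False using nx by simp
      qed
      from near_group_point_act[OF x gn this]
      have "near (r + 3 * \<delta>) (group_point (g n)) (act (g n) x)"
        by (rule near_antimono) (use elim(3) in linarith)
      from near_trans[OF b(1) group_point_bord[OF gn] act_bord[OF xb gn] elim(2) this]
      show "near r p (act (g n) x)" by simp
    qed
  qed
qed

text \<open>The prefix of length \<open>n\<close> of a late term of a representative; the later
  terms agree with it up to one \<delta>.\<close>

lemma ex_ray:
  assumes "p \<in> bdry"
  shows "\<exists>g. g \<in> carrier G \<and> len g = n \<and> near (real n - \<delta>) (group_point g) p"
proof -
  have b: "p \<in> bord" using assms bdry_subset_bord by blast
  obtain x where x: "x \<in> p" using bord_ex_rep[OF b] ..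
  obtain N where N: "\<forall>i\<ge>N. \<forall>j\<ge>N. real n \<le> gp (x i) (x j)"
    using bdry_reps_close[OF assms x x] by meson
  have c: "x i \<in> carrier G" for i by (rule bord_carrier[OF b x])
  have "n \<le> len (x N)" using N gp_self[OF c, of N] by force
  then obtain h where h: "h \<in> carrier G" "len h = n" "gp h (x N) = real n"
    using ex_prefix[OF c] by metis
  have "near (real n - \<delta>) (group_point h) p"
  proof (rule near_group_pointI[OF x, of N])
    fix j assume "j \<ge> N"
    then show "real n - \<delta> \<le> gp h (x j)"
      using N h(3) by (intro gp_triangle_ge[OF h(1) c[of N] c[of j]]) auto
  qed
  then show ?thesis using h by auto
qed

text \<open>The points \<open>a\<close> and \<open>b\<close> are the limits of \<open>p\<close> and
  of the identity as seen from \<open>g n\<close>, and \<open>not_near_group_point_act\<close> keeps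
  these two directions apart. The last conclusion, that \<open>g n\<close> stays close to the ray,
  is kept for the length estimate in \<open>shortest_translates_avoid_wall\<close>.\<close>

lemma conical_dynamics:
  assumes "p \<in> bdry"
  obtains g a b where "range g \<subseteq> carrier G" "a \<in> bdry" "b \<in> bdry" "a \<noteq> b"
    "tends_to (\<lambda>n. group_point (g n)) p" "tends_to (\<lambda>n. group_point (inv (g n))) b"
    "tends_to (\<lambda>n. act (inv (g n)) p) a"
    "\<And>n. near (real (len (g n)) - \<delta>) (group_point (g n)) p"
proof -
  have pb: "p \<in> bord" using assms bdry_subset_bord by blast
  have "\<forall>n. \<exists>g. g \<in> carrier G \<and> len g = n \<and> near (real n - \<delta>) (group_point g) p"
    using ex_ray[OF assms] by simp
  from choice[OF this] obtain f where "\<forall>n. f n \<in> carrier G \<and> len (f n) = n \<and> near (real n - \<delta>) (group_point (f n)) p"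
    ..
  then have f: "\<And>n. f n \<in> carrier G" "\<And>n. len (f n) = n"
    "\<And>n. near (real n - \<delta>) (group_point (f n)) p"
    by simp_all
  have "filterlim (\<lambda>n. len (inv (f n))) at_top sequentially"
    by (rule filterlim_at_top_nat_ge) (simp add: len_inv f)
  then obtain b \<phi> where b: "b \<in> bdry" "strict_mono \<phi>"
    "tends_to (\<lambda>n. group_point (inv (f (\<phi> n)))) b"
    by (rule group_seq_compact[rotated]) (use f(1) in auto)
  have "range (\<lambda>n. act (inv (f (\<phi> n))) p) \<subseteq> bdry" using act_bdry[OF assms] f(1) by auto
  then obtain a \<psi> where a: "a \<in> bdry" "strict_mono \<psi>"
    "tends_to (\<lambda>n. act (inv (f (\<phi> (\<psi> n)))) p) a"
    by (rule bdry_seq_compact)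
  define g where "g n = f (\<phi> (\<psi> n))" for n
  have g: "g n \<in> carrier G" for n using f(1) by (simp add: g_def)
  have g_near: "near (real (len (g n)) - \<delta>) (group_point (g n)) p" for n
    using f(2,3) by (simp add: g_def)
  have g_inv: "tends_to (\<lambda>n. group_point (inv (g n))) b"
    unfolding g_def by (rule tends_to_filterlim[OF b(3) filterlim_subseq[OF a(2)]])
  have g_p: "tends_to (\<lambda>n. group_point (g n)) p"
    unfolding tends_to_def eventually_sequentially
  proof
    fix r
    have "near r p (group_point (g n))" if n: "n \<ge> nat \<lceil>r + \<delta>\<rceil>" for n
    proof -
      have "n \<le> \<phi> (\<psi> n)" using seq_suble[OF b(2)] seq_suble[OF a(2)] order_trans by metis
      moreover have "len (g n) = \<phi> (\<psi> n)" using f(2) by (simp add: g_def)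
      ultimately have "r \<le> real (len (g n)) - \<delta>" using n by linarith
      then show ?thesis
        using near_sym[OF group_point_bord[OF g] pb] near_antimono[OF g_near] by simp
    qed
    then show "\<exists>N. \<forall>n\<ge>N. near r p (group_point (g n))" by meson
  qed
  have "a \<noteq> b"
  proof
    assume "a = b"
    \<comment> \<open>After the 3\<delta> lost in \<open>near_trans\<close>, 8\<delta> + 1 leaves
      exactly the value 5\<delta> + 1 excluded by \<open>not_near_group_point_act\<close> with
      \<open>r\<close> = \<delta>.\<close>
    have "\<forall>\<^sub>F n in sequentially. near (8 * \<delta> + 1) b (group_point (inv (g n)))
        \<and> near (8 * \<delta> + 1) b (act (inv (g n)) p)"
      using g_inv a(3) \<open>a = b\<close> unfolding tends_to_def g_def by (intro eventually_conj) simp_all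
    then obtain n where n: "near (8 * \<delta> + 1) b (group_point (inv (g n)))"
      "near (8 * \<delta> + 1) b (act (inv (g n)) p)"
      using eventually_happens'[OF sequentially_bot] by auto
    have bb: "b \<in> bord" and ib: "group_point (inv (g n)) \<in> bord" and ab: "act (inv (g n)) p \<in> bord"
      using b(1) bdry_subset_bord group_point_bord act_bord[OF pb] g by auto
    have "near (8 * \<delta> + 1 - 3 * \<delta>) (group_point (inv (g n))) (act (inv (g n)) p)"
      by (rule near_trans[OF ib bb ab near_sym[OF bb ib n(1)] n(2)])
    moreover have "\<not> near (\<delta> + 4 * \<delta> + 1) (group_point (inv (g n))) (act (inv (g n)) p)"
      by (rule not_near_group_point_act[OF assms g g_near])
    ultimately show False by simp
  qed
  moreover have "tends_to (\<lambda>n. act (inv (g n)) p) a" using a(3) by (simp add: g_def)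
  moreover have "range g \<subseteq> carrier G" using g by auto
  ultimately show thesis using that[of g a b] a(1) b(1) g_p g_inv g_near by simp
qed

end

section \<open>Divisions\<close>

lemma ex_injective_subseq:
  fixes f :: "nat \<Rightarrow> 'b"
  assumes "infinite (range f)"
  obtains r :: "nat \<Rightarrow> nat" where "strict_mono r" "inj (\<lambda>i. f (r i))"
proof -
  define A where "A = {n. \<forall>m<n. f m \<noteq> f n}"
  have "range f \<subseteq> f ` A"
  proof
    fix y assume "y \<in> range f"
    then obtain n where n: "f n = y" by auto
    define k where "k = (LEAST n. f n = y)"
    have fk: "f k = y" unfolding k_def by (rule LeastI[of "\<lambda>n. f n = y", OF n])
    have "f m \<noteq> y" if "m < k" for m using not_less_Least[of m "\<lambda>n. f n = y"] that unfolding k_def by simp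
    then have "k \<in> A" using fk by (simp add: A_def)
    with fk show "y \<in> f ` A" by auto
  qed
  then have "infinite A" using assms finite_subset by auto
  then obtain r :: "nat \<Rightarrow> nat" where r: "strict_mono r" "\<forall>n. r n \<in> A"
    using infinite_enumerate[of A] by auto
  have "f (r i) \<noteq> f (r j)" if "i < j" for i j
    using r that unfolding A_def strict_mono_def by simp
  then have "inj (\<lambda>i. f (r i))" by (rule linorder_injI)
  then show thesis using that r(1) by simp
qed

locale division_system = hyperbolic_group_const G S \<delta> for G (structure) and S and \<delta> +
  fixes \<D> :: "'a bpoint division set"
  assumes path_connected: "path_connected_space (boundary_topology G S)"
    and no_path_cut_point: "\<not> path_cut_point (boundary_topology G S) p"
    and division: "D \<in> \<D> \<Longrightarrow> is_division (boundary_topology G S) D"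
    and G_finite: "G_finite G (boundary_act G) \<D>"
    and point_convergent: "point_convergent (boundary_topology G S) \<D>"
begin

abbreviation dact :: "'a \<Rightarrow> 'a bpoint division \<Rightarrow> 'a bpoint division" where
  "dact \<equiv> division_act act"

text \<open>The sides form an unordered pair, so the other side is described as a
  complement.\<close>

definition opposite :: "'a bpoint division \<Rightarrow> 'a bpoint set \<Rightarrow> 'a bpoint set" where
  "opposite D E = bdry - fst D - E"

section \<open>Sides, walls and paths\<close>

lemma wall_subset:
  assumes "D \<in> \<D>"
  shows "fst D \<subseteq> bdry"
  using closedin_subset[of "boundary_topology G S" "fst D"] division[OF assms]
  unfolding is_division_def by simp

lemma ex_side:
  assumes "D \<in> \<D>"
  shows "\<exists>E. E \<in> snd D"
  using division[OF assms] unfolding is_division_def by auto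

lemma side:
  assumes "D \<in> \<D>" "E \<in> snd D"
  shows side_nonempty: "E \<noteq> {}" and sides_eq: "snd D = {E, opposite D E}"
    and side_subset: "E \<subseteq> bdry" and side_disjoint: "E \<inter> fst D = {}"
    and side_open: "openin (boundary_topology G S) E"
    and side_closed: "closedin (boundary_topology G S) (E \<union> fst D)"
proof -
  let ?T = "boundary_topology G S"
  obtain A B where AB: "snd D = {A, B}" "A \<inter> B = {}" "A \<union> B = topspace ?T - fst D"
    "\<forall>E\<in>{A, B}. E \<noteq> {} \<and> openin (subtopology ?T (topspace ?T - fst D)) E \<and>
      closedin (subtopology ?T (topspace ?T - fst D)) E \<and> ?T closure_of E = E \<union> fst D"
    using division[OF assms(1)] unfolding is_division_def by auto
  have E: "E = A \<or> E = B" using AB(1) assms(2) by simp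
  have c: "closedin ?T (fst D)" using division[OF assms(1)] unfolding is_division_def by simp
  have props: "E \<noteq> {} \<and> openin (subtopology ?T (topspace ?T - fst D)) E \<and> ?T closure_of E = E \<union> fst D"
    using AB(4) E by auto
  then show "E \<noteq> {}" by simp
  show "snd D = {E, opposite D E}" unfolding opposite_def using AB(1,2,3) E by auto
  show "E \<subseteq> bdry" "E \<inter> fst D = {}" using AB(3) E by auto
  have "openin ?T (topspace ?T - fst D)" using c by blast
  then show "openin ?T E" using props openin_open_subtopology by auto
  show "closedin ?T (E \<union> fst D)" using props closedin_closure_of[of ?T E] by simp
qed

lemma opposite_side:
  assumes "D \<in> \<D>" "E \<in> snd D"
  shows "opposite D E \<in> snd D" "opposite D E \<noteq> E"
  using sides_eq[OF assms] side_nonempty[OF assms] unfolding opposite_def by auto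

lemma side_not_near:
  assumes "D \<in> \<D>" "E \<in> snd D" "p \<in> bdry" "p \<notin> E \<union> fst D"
  obtains r where "\<And>x. x \<in> E \<union> fst D \<Longrightarrow> \<not> near r p x"
  using closedin_boundary_not_near[OF side_closed[OF assms(1,2)] assms(3,4)] by auto

text \<open>Off the wall, the two sides would be disjoint open sets separating the connected image
  of the path.\<close>

lemma path_meets_wall:
  assumes "D \<in> \<D>" "E \<in> snd D" "pathin (boundary_topology G S) \<gamma>" "\<gamma> 0 \<in> E" "\<gamma> 1 \<in> opposite D E"
  shows "\<gamma> ` {0..1} \<inter> fst D \<noteq> {}"
proof
  let ?T = "boundary_topology G S" and ?I = "\<gamma> ` {0..1}"
  assume disj: "?I \<inter> fst D = {}"
  have con: "connectedin ?T ?I" by (rule connectedin_path_image[OF assms(3)])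
  then have "?I \<subseteq> bdry" using connectedin_subset_topspace by force
  then have "?I \<subseteq> E \<union> opposite D E" using disj unfolding opposite_def by auto
  moreover have "openin ?T E" "openin ?T (opposite D E)"
    using side_open[OF assms(1)] assms(2) opposite_side[OF assms(1,2)] by auto
  moreover have "E \<inter> opposite D E = {}" unfolding opposite_def by auto
  moreover have "E \<inter> ?I \<noteq> {}" "opposite D E \<inter> ?I \<noteq> {}" using assms(4,5) by force+
  ultimately show False using con unfolding connectedin by blast
qed

text \<open>A path joining the two sides exists and must meet the wall, so the wall is not empty. If
  it were \<open>{p}\<close>, all such paths would pass through \<open>p\<close>, a path cut
  point.\<close>

lemma wall_nontrivial:
  assumes "D \<in> \<D>"
  shows "\<exists>c\<in>fst D. c \<noteq> p"
proof (rule ccontr)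
  let ?T = "boundary_topology G S"
  assume "\<not> (\<exists>c\<in>fst D. c \<noteq> p)"
  then have sub: "fst D \<subseteq> {p}" by auto
  obtain E where E: "E \<in> snd D" using ex_side[OF assms] ..
  note E' = opposite_side(1)[OF assms E]
  obtain a b where a: "a \<in> E" and b: "b \<in> opposite D E"
    using side_nonempty[OF assms E] side_nonempty[OF assms E'] by blast
  have ab: "a \<in> topspace ?T" "b \<in> topspace ?T" "a \<notin> fst D" "b \<notin> fst D"
    using a b side_subset[OF assms E] side_disjoint[OF assms E] unfolding opposite_def by auto
  have meets: "p \<in> \<gamma> ` {0..1} \<and> fst D = {p}" if "pathin ?T \<gamma>" "\<gamma> 0 = a" "\<gamma> 1 = b" for \<gamma>
  proof -
    have "\<gamma> ` {0..1} \<inter> fst D \<noteq> {}"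
      by (rule path_meets_wall[OF assms E that(1)]) (use that a b in auto)
    then show ?thesis using sub by auto
  qed
  obtain \<gamma> where "pathin ?T \<gamma>" "\<gamma> 0 = a" "\<gamma> 1 = b"
    using path_connected ab(1,2) unfolding path_connected_space_def by meson
  from meets[OF this] have D: "fst D = {p}" ..
  have pab: "p \<in> topspace ?T" "a \<in> topspace ?T - {p}" "b \<in> topspace ?T - {p}"
    using ab D wall_subset[OF assms] by auto
  have "\<forall>\<gamma>. pathin ?T \<gamma> \<and> \<gamma> 0 = a \<and> \<gamma> 1 = b \<longrightarrow> p \<in> \<gamma> ` {0..1}"
    using meets by simp
  then have "\<exists>b\<in>topspace ?T - {p}. \<forall>\<gamma>. pathin ?T \<gamma> \<and> \<gamma> 0 = a \<and> \<gamma> 1 = b \<longrightarrow> p \<in> \<gamma> ` {0..1}"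
    using pab(3) by (rule bexI)
  then have "\<exists>a\<in>topspace ?T - {p}. \<exists>b\<in>topspace ?T - {p}.
      \<forall>\<gamma>. pathin ?T \<gamma> \<and> \<gamma> 0 = a \<and> \<gamma> 1 = b \<longrightarrow> p \<in> \<gamma> ` {0..1}"
    using pab(2) by (rule bexI)
  then have "path_cut_point ?T p"
    unfolding path_cut_point_def using pab(1) by simp
  then show False using no_path_cut_point by simp
qed

section \<open>The action on divisions and its orbits\<close>

lemma dact_closed: "D \<in> \<D> \<Longrightarrow> g \<in> carrier G \<Longrightarrow> dact g D \<in> \<D>"
  using G_finite unfolding G_finite_def by simp

lemma fst_dact: "fst (dact g D) = act g ` fst D"
  by (simp add: division_act_def)

lemma snd_dact: "snd (dact g D) = (`) (act g) ` snd D"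
  by (simp add: division_act_def)

lemma act_one_image: "A \<subseteq> bdry \<Longrightarrow> act \<one> ` A = A"
  using act_one bdry_subset_bord by (simp add: subset_iff)

lemma act_mult_image:
  assumes "A \<subseteq> bdry" "g \<in> carrier G" "h \<in> carrier G"
  shows "act (g \<otimes> h) ` A = act g ` act h ` A"
  unfolding image_image
  by (rule image_cong) (use assms act_mult bdry_subset_bord in \<open>auto simp: subset_iff\<close>)

lemma dact_one:
  assumes "D \<in> \<D>"
  shows "dact \<one> D = D"
proof -
  have "(`) (act \<one>) ` snd D = snd D"
    using act_one_image[OF side_subset[OF assms]] by simp
  then show ?thesis
    using act_one_image[OF wall_subset[OF assms]] by (simp add: division_act_def)
qed

lemma dact_mult:
  assumes "D \<in> \<D>" "g \<in> carrier G" "h \<in> carrier G"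
  shows "dact (g \<otimes> h) D = dact g (dact h D)"
proof -
  have "(`) (act (g \<otimes> h)) ` snd D = (`) (act g) ` (`) (act h) ` snd D"
    unfolding image_image[of "(`) (act g)"]
    by (rule image_cong) (use act_mult_image[OF side_subset[OF assms(1)] assms(2,3)] in auto)
  then show ?thesis
    using act_mult_image[OF wall_subset[OF assms(1)] assms(2,3)] by (simp add: division_act_def)
qed

lemma dact_inv:
  assumes "D \<in> \<D>" "g \<in> carrier G"
  shows "dact (inv g) (dact g D) = D" "dact g (dact (inv g) D) = D"
  using dact_mult[OF assms(1), of "inv g" g] dact_mult[OF assms(1), of g "inv g"] dact_one assms
  by simp_all

lemma ex_orbit_subseq:
  fixes D :: "nat \<Rightarrow> 'a bpoint division"
  assumes "range D \<subseteq> \<D>"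
  obtains D0 and \<phi> :: "nat \<Rightarrow> nat" where "D0 \<in> \<D>" "strict_mono \<phi>"
    "\<And>i. \<exists>f\<in>carrier G. dact f D0 = D (\<phi> i)"
proof -
  have DD: "D i \<in> \<D>" for i using assms by auto
  have "range (\<lambda>i. orbit G dact (D i)) \<subseteq> orbits G \<D> dact"
    unfolding orbits_def by (rule image_subsetI) (use DD in blast)
  moreover have "finite (orbits G \<D> dact)" using G_finite unfolding G_finite_def by simp
  ultimately have "finite (range (\<lambda>i. orbit G dact (D i)))" by (rule finite_subset)
  then obtain c and \<phi> :: "nat \<Rightarrow> nat" where \<phi>: "strict_mono \<phi>" "\<And>i. orbit G dact (D (\<phi> i)) = c"
    by (rule ex_constant_subseq) blast
  have "\<exists>f\<in>carrier G. dact f (D (\<phi> 0)) = D (\<phi> i)" for i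
  proof -
    have "D (\<phi> i) \<in> orbit G dact (D (\<phi> i))"
      unfolding orbit_def using dact_one[OF DD[of "\<phi> i"]] by force
    then have "D (\<phi> i) \<in> orbit G dact (D (\<phi> 0))" using \<phi>(2)[of i] \<phi>(2)[of 0] by simp
    then show ?thesis unfolding orbit_def by auto
  qed
  then show thesis by (rule that[OF DD \<phi>(1)])
qed

section \<open>Conical wall points and shrinking sides\<close>

lemma tends_to_act:
  assumes "range g \<subseteq> carrier G" "p \<in> bdry" "q \<in> bdry" "x \<in> bdry" "x \<noteq> q"
    and "tends_to (\<lambda>n. group_point (g n)) p" "tends_to (\<lambda>n. group_point (inv (g n))) q"
  shows "tends_to (\<lambda>n. act (g n) x) p"
proof -
  obtain R where "\<not> near R q x" using near_all_eq[OF assms(3,4)] assms(5) by auto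
  show ?thesis
    unfolding tends_to_def
  proof
    fix r
    show "\<forall>\<^sub>F n in sequentially. near r p (act (g n) x)"
      using convergence_dynamics[OF assms(1,2,3,6,7), of R r]
      by (rule eventually_mono) (use assms(4) \<open>\<not> near R q x\<close> in simp)
  qed
qed

text \<open>Every point of a wall is a conical limit point of the stabilizer of its division: zooming in
  on the point produces walls that accumulate at two points, hence only finitely many divisions.\<close>

lemma wall_point_conical:
  assumes "D0 \<in> \<D>" "p \<in> fst D0"
  obtains g u where "range g \<subseteq> carrier G" "u \<in> carrier G"
    "tends_to (\<lambda>n. group_point (g n)) p"
    "\<And>n. near (real (len (g n)) - \<delta>) (group_point (g n)) p"
    "\<And>n. dact (g n \<otimes> u) D0 = D0"
proof -
  let ?T = "boundary_topology G S"
  have pb: "p \<in> bdry" using wall_subset[OF assms(1)] assms(2) by auto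
  obtain g a b where g: "range g \<subseteq> carrier G" "a \<in> bdry" "b \<in> bdry" "a \<noteq> b"
    "tends_to (\<lambda>n. group_point (g n)) p" "tends_to (\<lambda>n. group_point (inv (g n))) b"
    "tends_to (\<lambda>n. act (inv (g n)) p) a"
    "\<And>n. near (real (len (g n)) - \<delta>) (group_point (g n)) p"
    using conical_dynamics[OF pb] by metis
  have gc: "g n \<in> carrier G" for n using g(1) by auto
  obtain c where c: "c \<in> fst D0" "c \<noteq> p" using wall_nontrivial[OF assms(1)] by auto
  have cb: "c \<in> bdry" using wall_subset[OF assms(1)] c(1) by auto
  have lim_c: "tends_to (\<lambda>n. act (inv (g n)) c) b"
    by (rule tends_to_act[OF _ g(3) pb cb c(2) g(6)]) (use gc g(5) in auto)
  define C where "C n = act (inv (g n)) ` fst D0" for n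
  \<comment> \<open>Along an injective subsequence of the walls \<open>C n\<close>, the images of
    \<open>p\<close> and of the second wall point \<open>c\<close> would put both \<open>a\<close>
    and \<open>b\<close> into the limit.\<close>
  have "finite (range C)"
  proof (rule ccontr)
    assume "infinite (range C)"
    then obtain r :: "nat \<Rightarrow> nat" where r: "strict_mono r" "inj (\<lambda>i. C (r i))"
      by (rule ex_injective_subseq)
    have CD: "C n \<in> fst ` \<D>" for n
      unfolding C_def fst_dact[symmetric]
      by (rule imageI) (rule dact_closed[OF assms(1) inv_closed[OF gc]])
    have lim: "q \<in> lim_sets ?T (\<lambda>i. C (r i))"
      if "x \<in> fst D0" "q \<in> bdry" "tends_to (\<lambda>n. act (inv (g n)) x) q" for x q
    proof -
      have "x \<in> bdry" using that(1) wall_subset[OF assms(1)] by auto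
      then have "limitin ?T (\<lambda>i. act (inv (g (r i))) x) q sequentially"
        by (intro tends_to_limitin tends_to_filterlim[OF that(3) filterlim_subseq[OF r(1)]] that(2))
          (use act_bdry gc in auto)
      then show ?thesis unfolding lim_sets_def C_def using that(1) by auto
    qed
    have "point_convergent_sets ?T (fst ` \<D>)"
      using point_convergent unfolding point_convergent_def by simp
    then have "inj (\<lambda>i. C (r i)) \<and> range (\<lambda>i. C (r i)) \<subseteq> fst ` \<D> \<longrightarrow>
        (\<forall>p\<in>lim_sets ?T (\<lambda>i. C (r i)). \<forall>q\<in>lim_sets ?T (\<lambda>i. C (r i)). p = q)"
      unfolding point_convergent_sets_def by (rule spec)
    moreover have "range (\<lambda>i. C (r i)) \<subseteq> fst ` \<D>" by (intro image_subsetI CD)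
    ultimately have "\<forall>p\<in>lim_sets ?T (\<lambda>i. C (r i)). \<forall>q\<in>lim_sets ?T (\<lambda>i. C (r i)). p = q"
      using r(2) by simp
    then show False using lim[OF assms(2) g(2,7)] lim[OF c(1) g(3) lim_c] g(4) by simp
  qed
  then obtain K and r :: "nat \<Rightarrow> nat" where r: "strict_mono r" "\<And>i. C (r i) = K"
    by (rule ex_constant_subseq) blast
  have "K \<subseteq> topspace ?T"
    using r(2)[of 0] wall_subset[OF dact_closed[OF assms(1) inv_closed[OF gc]]]
    unfolding C_def fst_dact by auto
  \<comment> \<open>The other clause of point-convergence: a wall carries finitely many divisions,
    so constancy passes from walls to divisions.\<close>
  then have "finite {D \<in> \<D>. fst D = K}"
    using point_convergent unfolding point_convergent_def by simp
  moreover have "range (\<lambda>i. dact (inv (g (r i))) D0) \<subseteq> {D \<in> \<D>. fst D = K}"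
    using r(2) dact_closed[OF assms(1) inv_closed[OF gc]] unfolding C_def by (auto simp: fst_dact)
  ultimately have "finite (range (\<lambda>i. dact (inv (g (r i))) D0))" by (rule finite_subset[rotated])
  then obtain D' and s :: "nat \<Rightarrow> nat" where s: "strict_mono s" "\<And>i. dact (inv (g (r (s i)))) D0 = D'"
    by (rule ex_constant_subseq) blast
  define f where "f i = g (r (s i))" for i
  have fc: "f i \<in> carrier G" for i using gc by (simp add: f_def)
  \<comment> \<open>All \<open>inv (f i)\<close> carry \<open>D0\<close> to the same division, so
    the fixed factor \<open>inv (f 0)\<close> corrects every \<open>f i\<close> to a stabilizer
    element.\<close>
  have "dact (f i \<otimes> inv (f 0)) D0 = D0" for i
  proof -
    have "dact (f i \<otimes> inv (f 0)) D0 = dact (f i) (dact (inv (f 0)) D0)"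
      by (rule dact_mult[OF assms(1) fc inv_closed[OF fc]])
    also have "dact (inv (f 0)) D0 = dact (inv (f i)) D0" using s(2) by (simp add: f_def)
    also have "dact (f i) \<dots> = D0" by (rule dact_inv(2)[OF assms(1) fc])
    finally show ?thesis .
  qed
  moreover have "tends_to (\<lambda>n. group_point (f n)) p"
    unfolding f_def
    by (intro tends_to_filterlim[OF tends_to_filterlim[OF g(5) filterlim_subseq[OF r(1)]]
      filterlim_subseq[OF s(1)]])
  moreover have "near (real (len (f n)) - \<delta>) (group_point (f n)) p" for n
    using g(8) by (simp add: f_def)
  moreover have "range f \<subseteq> carrier G" using fc by auto
  ultimately show thesis using that[of f "inv (f 0)"] fc by simp
qed

text \<open>If \<open>q\<close> were on the wall, some \<open>g n\<close> with
  \<open>g n \<otimes> u\<close> in the stabilizer would nearly follow a geodesic to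
  \<open>inv (f i)\<close>. Then \<open>f i \<otimes> g n\<close> is shorter than \<open>f i\<close>
  by about \<open>len (g n)\<close>, and the bounded correction \<open>u\<close> cannot restore
  this, against minimality.\<close>

lemma shortest_translates_avoid_wall:
  assumes "D0 \<in> \<D>" "range f \<subseteq> carrier G"
    and min: "\<And>i h. h \<in> carrier G \<Longrightarrow> dact h D0 = D0 \<Longrightarrow> len (f i) \<le> len (f i \<otimes> h)"
    and "q \<in> bdry" "tends_to (\<lambda>i. group_point (inv (f i))) q"
  shows "q \<notin> fst D0"
proof
  assume "q \<in> fst D0"
  then obtain g u where g: "range g \<subseteq> carrier G" "u \<in> carrier G"
    "tends_to (\<lambda>n. group_point (g n)) q"
    "\<And>n. near (real (len (g n)) - \<delta>) (group_point (g n)) q"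
    "\<And>n. dact (g n \<otimes> u) D0 = D0"
    using wall_point_conical[OF assms(1)] by metis
  have fc: "f i \<in> carrier G" and gc: "g i \<in> carrier G" for i using assms(2) g(1) by auto
  \<comment> \<open>The product of \<open>g n\<close> with \<open>inv (f i)\<close> falls short of
    \<open>len (g n)\<close> by at most \<delta> + 3\<delta>, and lengths enter the product halved:
    hence 8\<delta>. The rest beats \<open>len u\<close>.\<close>
  have "\<forall>\<^sub>F n in sequentially. 8 * \<delta> + real (len u) + 1 \<le> real (len (g n))"
    by (rule tends_to_len[OF g(3) assms(4) g(1)])
  then obtain n where n: "8 * \<delta> + real (len u) + 1 \<le> real (len (g n))"
    using eventually_happens'[OF sequentially_bot] by auto
  have "\<forall>\<^sub>F i in sequentially. near (real (len (g n)) - \<delta>) q (group_point (inv (f i)))"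
    using assms(5) unfolding tends_to_def by simp
  then obtain i where i: "near (real (len (g n)) - \<delta>) q (group_point (inv (f i)))"
    using eventually_happens'[OF sequentially_bot] by auto
  have "near (real (len (g n)) - \<delta> - 3 * \<delta>) (group_point (g n)) (group_point (inv (f i)))"
    by (rule near_trans[OF group_point_bord[OF gc] subsetD[OF bdry_subset_bord assms(4)]
      group_point_bord[OF inv_closed[OF fc]] g(4) i])
  then have *: "real (len (g n)) - 4 * \<delta> \<le> gp (g n) (inv (f i))" by (simp add: near_group_point)
  have "inv (g n) \<otimes> inv (f i) = inv (f i \<otimes> g n)" using inv_mult_group[OF fc gc] by simp
  then have "len (inv (g n) \<otimes> inv (f i)) = len (f i \<otimes> g n)" using len_inv fc gc by simp
  then have gp: "gp (g n) (inv (f i)) = (real (len (g n)) + real (len (f i)) - real (len (f i \<otimes> g n))) / 2"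
    using gp_eq[OF gc inv_closed[OF fc]] len_inv[OF fc] by simp
  have "len (f i) \<le> len (f i \<otimes> (g n \<otimes> u))" using min g(2,5) gc by simp
  also have "\<dots> = len (f i \<otimes> g n \<otimes> u)" using m_assoc[OF fc gc g(2)] by simp
  also have "\<dots> \<le> len (f i \<otimes> g n) + len u" by (rule len_mult[OF m_closed[OF fc gc] g(2)])
  finally have "real (len (f i)) \<le> real (len (f i \<otimes> g n)) + real (len u)" by linarith
  then show False using * n unfolding gp by (simp add: field_simps)
qed

text \<open>Distinct divisions in one orbit are translates of a single division by group elements of
  minimal length, whose inverses accumulate off the wall; convergence dynamics then shrinks the
  side away from the accumulation point.\<close>

lemma small_sides:
  fixes D :: "nat \<Rightarrow> 'a bpoint division"
  assumes "inj D" "range D \<subseteq> \<D>"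
  obtains \<phi> :: "nat \<Rightarrow> nat" and N p where "strict_mono \<phi>" "p \<in> bdry" "\<And>i. N i \<in> snd (D (\<phi> i))"
    "\<And>r. \<forall>\<^sub>F i in sequentially. \<forall>x\<in>N i \<union> fst (D (\<phi> i)). near r p x"
proof -
  obtain D0 and \<phi> :: "nat \<Rightarrow> nat" where D0: "D0 \<in> \<D>" "strict_mono \<phi>"
    "\<And>i. \<exists>f\<in>carrier G. dact f D0 = D (\<phi> i)"
    using ex_orbit_subseq[OF assms(2)] by metis
  \<comment> \<open>The elements taking \<open>D0\<close> to a given division form a left coset of
    the stabilizer of \<open>D0\<close>; a shortest one cannot be shortened by a stabilizer element
    on the right.\<close>
  have "\<exists>f. (f \<in> carrier G \<and> dact f D0 = D (\<phi> i)) \<and>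
      (\<forall>f'. f' \<in> carrier G \<and> dact f' D0 = D (\<phi> i) \<longrightarrow> len f \<le> len f')" for i
    using ex_has_least_nat[of "\<lambda>f. f \<in> carrier G \<and> dact f D0 = D (\<phi> i)" _ len] D0(3)[of i] by auto
  then have "\<forall>i. \<exists>f. (f \<in> carrier G \<and> dact f D0 = D (\<phi> i)) \<and>
      (\<forall>f'. f' \<in> carrier G \<and> dact f' D0 = D (\<phi> i) \<longrightarrow> len f \<le> len f')" by simp
  from choice[OF this] obtain f where "\<forall>i. (f i \<in> carrier G \<and> dact (f i) D0 = D (\<phi> i)) \<and>
      (\<forall>f'. f' \<in> carrier G \<and> dact f' D0 = D (\<phi> i) \<longrightarrow> len (f i) \<le> len f')" ..
  then have f: "\<And>i. f i \<in> carrier G" "\<And>i. dact (f i) D0 = D (\<phi> i)"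
    "\<And>i f'. f' \<in> carrier G \<Longrightarrow> dact f' D0 = D (\<phi> i) \<Longrightarrow> len (f i) \<le> len f'"
    by simp_all
  have min: "len (f i) \<le> len (f i \<otimes> h)" if "h \<in> carrier G" "dact h D0 = D0" for i h
    by (rule f(3)) (use that f(1,2) dact_mult[OF D0(1)] in auto)
  have "inj f"
  proof (rule injI)
    fix i j assume "f i = f j"
    then have "D (\<phi> i) = D (\<phi> j)" using f(2)[of i] f(2)[of j] by simp
    then have "\<phi> i = \<phi> j" using assms(1) by (simp add: inj_eq)
    then show "i = j" using D0(2) by (simp add: strict_mono_eq)
  qed
  then have lim_f: "filterlim (\<lambda>n. len (f n)) at_top sequentially"
    by (rule filterlim_len_inj) (use f(1) in auto)
  obtain p and \<psi> :: "nat \<Rightarrow> nat" where p: "p \<in> bdry" "strict_mono \<psi>"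
    "tends_to (\<lambda>n. group_point (f (\<psi> n))) p"
    by (rule group_seq_compact[OF _ lim_f]) (use f(1) in auto)
  have "filterlim (\<lambda>n. len (inv (f (\<psi> n)))) at_top sequentially"
    using filterlim_compose[OF lim_f filterlim_subseq[OF p(2)]] len_inv[OF f(1)] by simp
  then obtain q and \<rho> :: "nat \<Rightarrow> nat" where q: "q \<in> bdry" "strict_mono \<rho>"
    "tends_to (\<lambda>n. group_point (inv (f (\<psi> (\<rho> n))))) q"
    by (rule group_seq_compact[rotated]) (use f(1) in auto)
  define h where "h n = f (\<psi> (\<rho> n))" for n
  have hc: "h n \<in> carrier G" for n using f(1) by (simp add: h_def)
  have h_p: "tends_to (\<lambda>n. group_point (h n)) p"
    unfolding h_def by (rule tends_to_filterlim[OF p(3) filterlim_subseq[OF q(2)]])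
  have h_q: "tends_to (\<lambda>n. group_point (inv (h n))) q" using q(3) by (simp add: h_def)
  have h_range: "range h \<subseteq> carrier G" using hc by auto
  have "q \<notin> fst D0"
    by (rule shortest_translates_avoid_wall[OF D0(1) h_range _ q(1) h_q]) (use min in \<open>simp add: h_def\<close>)
  \<comment> \<open>As \<open>q\<close> is off the wall, one of the two closed sides misses it, and
    being closed it avoids a whole neighbourhood of the repelling point.\<close>
  obtain E where E: "E \<in> snd D0" "q \<notin> E \<union> fst D0"
  proof -
    obtain E where E: "E \<in> snd D0" using ex_side[OF D0(1)] ..
    show thesis
    proof (cases "q \<in> E")
      case True
      then have "q \<notin> opposite D0 E \<union> fst D0"
        using \<open>q \<notin> fst D0\<close> by (simp add: opposite_def)
      then show thesis using that opposite_side(1)[OF D0(1) E] by simp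
    next
      case False
      then show thesis using that E \<open>q \<notin> fst D0\<close> by simp
    qed
  qed
  obtain R where R: "\<And>x. x \<in> E \<union> fst D0 \<Longrightarrow> \<not> near R q x"
    by (rule side_not_near[OF D0(1) E(1) q(1) E(2)]) blast
  have EC: "E \<union> fst D0 \<subseteq> bdry" using side_subset[OF D0(1) E(1)] wall_subset[OF D0(1)] by simp
  define N where "N n = act (h n) ` E" for n
  define \<theta> where "\<theta> n = \<phi> (\<psi> (\<rho> n))" for n
  have hD: "dact (h n) D0 = D (\<theta> n)" for n using f(2) by (simp add: h_def \<theta>_def)
  have "strict_mono \<theta>"
    unfolding \<theta>_def using D0(2) p(2) q(2) by (simp add: strict_mono_def)
  moreover have "N n \<in> snd (D (\<theta> n))" for n
    unfolding hD[symmetric] snd_dact N_def using E(1) by (rule imageI)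
  moreover have "\<forall>\<^sub>F i in sequentially. \<forall>x\<in>N i \<union> fst (D (\<theta> i)). near r p x" for r
    using convergence_dynamics[OF h_range p(1) q(1) h_p h_q, of R r]
  proof eventually_elim
    case (elim n)
    have "N n \<union> fst (D (\<theta> n)) = act (h n) ` (E \<union> fst D0)"
      unfolding hD[symmetric] fst_dact N_def by (simp add: image_Un)
    then show ?case using elim R EC by auto
  qed
  ultimately show thesis using that[of \<theta> p N] p(1) by simp
qed

end

section \<open>Vertices of the dual cube complex\<close>

lemma finite_diff_trans: "finite (A - B) \<Longrightarrow> finite (B - C) \<Longrightarrow> finite (A - C)"
  by (rule finite_subset[of _ "(A - B) \<union> (B - C)"]) auto

lemma Z_edge_finite_diff:
  assumes "Z_edge X \<D> \<alpha> \<beta>"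
  shows "finite (\<alpha> - \<beta>)" "finite (\<beta> - \<alpha>)"
proof -
  obtain A where \<beta>: "\<beta> = (\<alpha> - {A}) \<union> {triples X \<D> - A}"
    using assms unfolding Z_edge_def by auto
  show "finite (\<alpha> - \<beta>)" by (rule finite_subset[of _ "{A}"]) (auto simp: \<beta>)
  show "finite (\<beta> - \<alpha>)" by (rule finite_subset[of _ "{triples X \<D> - A}"]) (auto simp: \<beta>)
qed

text \<open>Each vertex is compared with the corner \<open>f {}\<close> by adding one element of the
  index set at a time; an edge exchanges a single halfspace.\<close>

lemma Z_cube_finite_diff:
  assumes "Q \<in> Z_cubes X \<D>" "\<alpha> \<in> Q" "\<beta> \<in> Q"
  shows "finite (\<alpha> - \<beta>)"
proof -
  obtain n :: nat and f where Q: "Q = f ` Pow {..<n}"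
    "\<forall>s\<subseteq>{..<n}. \<forall>i\<in>{..<n} - s. Z_edge X \<D> (f s) (f (insert i s))"
    using assms(1) unfolding Z_cubes_def by auto
  have *: "finite (f s - f {}) \<and> finite (f {} - f s)" if "s \<subseteq> {..<n}" for s
  proof -
    have "finite s" using that finite_subset by auto
    then show ?thesis using that
    proof (induction s rule: finite_induct)
      case empty
      show ?case by simp
    next
      case (insert i s)
      then have "Z_edge X \<D> (f s) (f (insert i s))" using Q(2) by simp
      note e = Z_edge_finite_diff[OF this]
      have IH: "finite (f s - f {})" "finite (f {} - f s)" using insert by simp_all
      show ?case using finite_diff_trans[OF e(2) IH(1)] finite_diff_trans[OF IH(2) e(1)] by simp
    qed
  qed
  obtain s s' where "s \<subseteq> {..<n}" "s' \<subseteq> {..<n}" "\<alpha> = f s" "\<beta> = f s'"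
    using assms(2,3) Q(1) by auto
  then show ?thesis using finite_diff_trans[of "f s" "f {}" "f s'"] * by simp
qed

text \<open>The form in which membership in the component is used: a finite chain of cubes
  accumulates only finitely many exchanges.\<close>

lemma dual_complex_vertex_finite_diff:
  assumes "v \<in> dual_complex_vertices X \<D>"
  obtains t where "t \<in> triples X \<D>" "finite (v - principal_ultrafilter X \<D> t)"
proof -
  obtain t where t: "t \<in> triples X \<D>"
    "(principal_ultrafilter X \<D> t, v) \<in> {(\<alpha>, \<beta>). \<exists>Q\<in>Z_cubes X \<D>. \<alpha> \<in> Q \<and> \<beta> \<in> Q}\<^sup>*"
    using assms unfolding dual_complex_vertices_def by auto
  from t(2) have "finite (v - principal_ultrafilter X \<D> t)"
  proof (induction rule: rtrancl_induct)
    case base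
    show ?case by simp
  next
    case (step \<alpha> \<beta>)
    then obtain Q where "Q \<in> Z_cubes X \<D>" "\<beta> \<in> Q" "\<alpha> \<in> Q" by auto
    then have "finite (\<beta> - \<alpha>)" by (rule Z_cube_finite_diff)
    then show ?case using step.IH by (rule finite_diff_trans)
  qed
  then show thesis using that t(1) by simp
qed

lemma (in hyperbolic_group_const) finite_not_near:
  assumes "finite T" "T \<subseteq> bdry" "p \<in> bdry"
  shows "\<exists>r. \<forall>x\<in>T - {p}. \<not> near r p x"
  using assms(1,2)
proof (induction T rule: finite_induct)
  case empty
  show ?case by simp
next
  case (insert y T)
  then obtain r where r: "\<forall>x\<in>T - {p}. \<not> near r p x" by auto
  show ?case
  proof (cases "y = p")
    case True
    then have "\<forall>x\<in>insert y T - {p}. \<not> near r p x" using r by simp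
    then show ?thesis ..
  next
    case False
    then obtain s where s: "\<not> near s p y" using near_all_eq[OF assms(3), of y] insert.prems by auto
    have "\<forall>x\<in>insert y T - {p}. \<not> near (max r s) p x"
      using r s near_antimono[of "max r s" p _ r] near_antimono[of "max r s" p _ s] by auto
    then show ?thesis ..
  qed
qed

text \<open>\<open>t\<close> is a base triple: \<open>v\<close> is compared with its principal
  ultrafilter, and membership of \<open>t\<close> decides which of two sides is meant.\<close>

locale division_vertex = division_system G S \<delta> \<D>
  for G (structure) and S and \<delta> and \<D> :: "'a bpoint division set" +
  fixes v :: "'a bpoint set set set" and t :: "'a bpoint set"
  assumes v_ultrafilter: "wall_ultrafilter (boundary_topology G S) \<D> v"
    and t_triple: "t \<in> triples (boundary_topology G S) \<D>"
    and v_finite_diff: "finite (v - principal_ultrafilter (boundary_topology G S) \<D> t)"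
begin

abbreviation T3 :: "'a bpoint set set" where "T3 \<equiv> triples (boundary_topology G S) \<D>"

abbreviation W :: "'a bpoint set \<Rightarrow> 'a bpoint set set" where
  "W \<equiv> halfspace (boundary_topology G S) \<D>"

abbreviation h :: "'a bpoint division \<Rightarrow> 'a bpoint set" where
  "h \<equiv> chosen_side (boundary_topology G S) \<D> v"

section \<open>The sides chosen by the ultrafilter\<close>

lemma triples_iff: "s \<in> T3 \<longleftrightarrow> s \<subseteq> bdry \<and> (\<forall>D\<in>\<D>. s \<inter> fst D = {}) \<and> card s = 3"
  unfolding triples_def by auto

lemma triple_finite: "s \<in> T3 \<Longrightarrow> finite s"
  unfolding triples_iff using card.infinite by force

lemma halfspace_iff: "s \<in> W E \<longleftrightarrow> s \<in> T3 \<and> 2 \<le> card (s \<inter> E)"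
  unfolding halfspace_def by simp

text \<open>A triple misses every wall, so its three points are shared between the two sides and
  exactly one side gets the majority.\<close>

lemma halfspace_opposite:
  assumes "D \<in> \<D>" "E \<in> snd D" "s \<in> T3"
  shows "s \<in> W (opposite D E) \<longleftrightarrow> s \<notin> W E"
proof -
  have "s \<inter> fst D = {}" "s \<subseteq> bdry" using assms(1,3) unfolding triples_iff by auto
  then have "s = (s \<inter> E) \<union> (s \<inter> opposite D E)" "(s \<inter> E) \<inter> (s \<inter> opposite D E) = {}"
    unfolding opposite_def by auto
  then have "card s = card (s \<inter> E) + card (s \<inter> opposite D E)"
    using card_Un_disjoint[of "s \<inter> E" "s \<inter> opposite D E"] triple_finite[OF assms(3)] by simp
  moreover have "card s = 3" using assms(3) unfolding triples_iff by simp
  ultimately show ?thesis using assms(3) unfolding halfspace_iff by auto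
qed

text \<open>One triple tells the two sides of a division apart. With \<open>s\<close> =
  \<open>t\<close>, a single membership test replaces an equality of sides throughout.\<close>

lemma side_eqI:
  assumes "D \<in> \<D>" "E \<in> snd D" "E' \<in> snd D" "s \<in> T3" "s \<in> W E \<longleftrightarrow> s \<in> W E'"
  shows "E = E'"
proof (rule ccontr)
  assume "E \<noteq> E'"
  then have "E' = opposite D E" using sides_eq[OF assms(1,2)] assms(3) by auto
  then show False using halfspace_opposite[OF assms(1,2,4)] assms(5) by simp
qed

lemma chosen_unique:
  assumes "D \<in> \<D>" "E \<in> snd D" "E' \<in> snd D" "W E \<in> v" "W E' \<in> v"
  shows "E = E'"
proof -
  have "\<exists>!A. A \<in> wall (boundary_topology G S) \<D> D \<and> A \<in> v"
    using v_ultrafilter assms(1) unfolding wall_ultrafilter_def by simp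
  moreover have "W E \<in> wall (boundary_topology G S) \<D> D" "W E' \<in> wall (boundary_topology G S) \<D> D"
    using assms(2,3) unfolding wall_def by auto
  ultimately have "W E = W E'" using assms(4,5) by auto
  then show ?thesis by (intro side_eqI[OF assms(1,2,3) t_triple]) simp
qed

lemma chosen_side:
  assumes "D \<in> \<D>"
  shows "h D \<in> snd D" "W (h D) \<in> v"
proof -
  have "\<exists>!A. A \<in> wall (boundary_topology G S) \<D> D \<and> A \<in> v"
    using v_ultrafilter assms unfolding wall_ultrafilter_def by simp
  then obtain E where E: "E \<in> snd D" "W E \<in> v" unfolding wall_def by auto
  have "h D = E"
    unfolding chosen_side_def
    by (rule the_equality) (use E chosen_unique[OF assms] in auto)
  with E show "h D \<in> snd D" "W (h D) \<in> v" by simp_all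
qed

lemma chosen_eqI: "D \<in> \<D> \<Longrightarrow> E \<in> snd D \<Longrightarrow> W E \<in> v \<Longrightarrow> h D = E"
  using chosen_unique chosen_side by simp

lemma chosen_subset: "D \<in> \<D> \<Longrightarrow> h D \<union> fst D \<subseteq> bdry"
  using side_subset[OF _ chosen_side(1)] wall_subset by simp

lemma vertex_eq: "v = (\<lambda>D. W (h D)) ` \<D>"
proof
  show "(\<lambda>D. W (h D)) ` \<D> \<subseteq> v" using chosen_side(2) by auto
  show "v \<subseteq> (\<lambda>D. W (h D)) ` \<D>"
  proof
    fix A assume A: "A \<in> v"
    then have "A \<in> halfspaces (boundary_topology G S) \<D>"
      using v_ultrafilter unfolding wall_ultrafilter_def by auto
    then obtain D E where D: "D \<in> \<D>" "E \<in> snd D" "A = W E"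
      unfolding halfspaces_def wall_def by auto
    then have "h D = E" using chosen_eqI A by simp
    then show "A \<in> (\<lambda>D. W (h D)) ` \<D>" using D by auto
  qed
qed

text \<open>The empty halfspace lies in every halfspace, so upward closure would place both
  halfspaces of its wall in \<open>v\<close>.\<close>

lemma empty_notin_vertex: "{} \<notin> v"
proof
  assume e: "{} \<in> v"
  then obtain D where D: "D \<in> \<D>" using vertex_eq by auto
  note E = chosen_side(1)[OF D]
  have "W (opposite D (h D)) \<in> halfspaces (boundary_topology G S) \<D>"
    unfolding halfspaces_def wall_def using D opposite_side(1)[OF D E] by auto
  then have "W (opposite D (h D)) \<in> v"
    using v_ultrafilter e unfolding wall_ultrafilter_def by simp
  then show False using chosen_eqI[OF D opposite_side(1)[OF D E]] opposite_side(2)[OF D E] by simp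
qed

lemma eventually_finite_avoid:
  assumes "finite T" "T \<subseteq> bdry" "p \<in> bdry"
    and "\<And>r. \<forall>\<^sub>F i in sequentially. \<forall>x\<in>A i. near r p x"
  shows "\<forall>\<^sub>F i in sequentially. T \<inter> A i \<subseteq> {p}"
proof -
  obtain r where r: "\<forall>x\<in>T - {p}. \<not> near r p x" using finite_not_near[OF assms(1-3)] ..
  from assms(4)[of r] show ?thesis by eventually_elim (use r in auto)
qed

text \<open>A set shrinking to \<open>p\<close> eventually contains no point of the triple except
  possibly \<open>p\<close>, hence no majority.\<close>

lemma eventually_notin_small_halfspace:
  assumes "s \<in> T3" "p \<in> bdry"
    and "\<And>r. \<forall>\<^sub>F i in sequentially. \<forall>x\<in>N i \<union> C i. near r p x"
  shows "\<forall>\<^sub>F i in sequentially. s \<notin> W (N i)"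
proof -
  have "s \<subseteq> bdry" using assms(1) unfolding triples_iff by simp
  from eventually_finite_avoid[OF triple_finite[OF assms(1)] this assms(2,3)]
  show ?thesis
  proof eventually_elim
    case (elim i)
    then have "s \<inter> N i \<subseteq> {p}" by auto
    then have "card (s \<inter> N i) \<le> card {p}" by (rule card_mono[rotated]) simp
    then show ?case unfolding halfspace_iff by simp
  qed
qed

text \<open>\<open>v_finite_diff\<close> counts halfspaces, and a priori many divisions could share
  one. Among infinitely many exceptional divisions some subsequence has shrinking sides; these are
  the chosen ones, since both kinds of side miss the majority of \<open>t\<close>. If finitely many
  halfspaces sufficed, one of them would recur, and a triple in it would lie in shrinking sides for
  ever.\<close>

lemma finite_exceptional: "finite {D \<in> \<D>. t \<notin> W (h D)}"
proof (rule ccontr)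
  assume "infinite {D \<in> \<D>. t \<notin> W (h D)}"
  from infinite_countable_subset[OF this] obtain D :: "nat \<Rightarrow> 'a bpoint division" where
    D: "inj D" "range D \<subseteq> {D \<in> \<D>. t \<notin> W (h D)}"
    by (elim exE conjE)
  then have DD: "range D \<subseteq> \<D>" "D i \<in> \<D>" "t \<notin> W (h (D i))" for i by auto
  obtain \<phi> :: "nat \<Rightarrow> nat" and N p where N: "strict_mono \<phi>" "p \<in> bdry" "\<And>i. N i \<in> snd (D (\<phi> i))"
    "\<And>r. \<forall>\<^sub>F i in sequentially. \<forall>x\<in>N i \<union> fst (D (\<phi> i)). near r p x"
    by (rule small_sides[OF D(1) DD(1)]) (rule that)
  have "W (h (D i)) \<in> v - principal_ultrafilter (boundary_topology G S) \<D> t" for i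
    using chosen_side(2)[OF DD(2)] DD(3) unfolding principal_ultrafilter_def by simp
  then have "range (\<lambda>i. W (h (D (\<phi> i)))) \<subseteq> v - principal_ultrafilter (boundary_topology G S) \<D> t"
    by auto
  then have "finite (range (\<lambda>i. W (h (D (\<phi> i)))))" using v_finite_diff by (rule finite_subset)
  then obtain A and r :: "nat \<Rightarrow> nat" where r: "strict_mono r" "\<And>i. W (h (D (\<phi> (r i)))) = A"
    by (rule ex_constant_subseq) blast
  have "A \<in> v" using r(2)[of 0] chosen_side(2)[OF DD(2)] by auto
  then have "A \<noteq> {}" using empty_notin_vertex by auto
  then obtain s where s: "s \<in> A" by auto
  then have "s \<in> T3" using r(2)[of 0] halfspace_iff by auto
  from eventually_notin_small_halfspace[OF this N(2,4)]
    eventually_notin_small_halfspace[OF t_triple N(2,4)]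
  have "\<forall>\<^sub>F i in sequentially. s \<notin> W (h (D (\<phi> i)))"
  proof eventually_elim
    case (elim i)
    have "h (D (\<phi> i)) = N i"
      by (rule side_eqI[OF DD(2) chosen_side(1)[OF DD(2)] N(3) t_triple]) (use elim(2) DD(3) in simp)
    then show ?case using elim(1) by simp
  qed
  then have "\<forall>\<^sub>F i in sequentially. s \<notin> W (h (D (\<phi> (r i))))"
    by (rule eventually_compose_filterlim[OF _ filterlim_subseq[OF r(1)]])
  then show False using r(2) s by simp
qed

text \<open>The chosen closed sides cannot shrink to a point: all but finitely many of them contain two
  points of \<open>t\<close>, and every wall has at least two points.\<close>

lemma chosen_sides_spread:
  assumes "q \<in> bdry"
  obtains r where "\<And>D. D \<in> \<D> \<Longrightarrow> \<exists>x\<in>h D \<union> fst D. \<not> near r q x"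
proof -
  define F where "F = {D \<in> \<D>. t \<notin> W (h D)}"
  have "\<forall>D\<in>F. \<exists>c. c \<in> fst D \<and> c \<noteq> q"
  proof
    fix D assume "D \<in> F"
    then have "D \<in> \<D>" by (simp add: F_def)
    from wall_nontrivial[OF this, of q] show "\<exists>c. c \<in> fst D \<and> c \<noteq> q" by auto
  qed
  from bchoice[OF this] obtain c where c: "\<forall>D\<in>F. c D \<in> fst D \<and> c D \<noteq> q" ..
  \<comment> \<open>Finite by \<open>finite_exceptional\<close>; one radius around \<open>q\<close>
    therefore excludes all its points other than \<open>q\<close>, and serves every
    division.\<close>
  have fin: "finite (t \<union> c ` F)"
    using finite_exceptional triple_finite[OF t_triple] by (simp add: F_def)
  have "c D \<in> bdry" if "D \<in> F" for D
  proof -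
    have "D \<in> \<D>" using that by (simp add: F_def)
    moreover have "c D \<in> fst D" using c that by simp
    ultimately show ?thesis using wall_subset by blast
  qed
  then have "t \<union> c ` F \<subseteq> bdry" using t_triple unfolding triples_iff by auto
  from finite_not_near[OF fin this assms] obtain r
    where r: "\<forall>x\<in>(t \<union> c ` F) - {q}. \<not> near r q x" ..
  have "\<exists>x\<in>h D \<union> fst D. \<not> near r q x" if D: "D \<in> \<D>" for D
  proof (cases "D \<in> F")
    case True
    then show ?thesis using r c by auto
  next
    case False
    then have "2 \<le> card (t \<inter> h D)" using D unfolding F_def halfspace_iff by simp
    then have "\<not> t \<inter> h D \<subseteq> {q}" using card_mono[of "{q}" "t \<inter> h D"] by auto
    then obtain x where "x \<in> t" "x \<in> h D" "x \<noteq> q" by auto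
    then show ?thesis using r by auto
  qed
  then show thesis by (rule that)
qed

section \<open>The stabilizer of the vertex in terms of chosen sides\<close>

lemma inj_on_act: "g \<in> carrier G \<Longrightarrow> inj_on (act g) bdry"
  by (rule inj_on_inverseI[where g = "act (inv g)"]) (use act_inv_act(1) bdry_subset_bord in auto)

lemma act_inv_image:
  assumes "A \<subseteq> bdry" "g \<in> carrier G"
  shows "act (inv g) ` act g ` A = A" "act g ` act (inv g) ` A = A"
  using act_mult_image[OF assms(1), of "inv g" g] act_mult_image[OF assms(1), of g "inv g"]
    act_one_image[OF assms(1)] assms(2) by simp_all

lemma act_triple:
  assumes "s \<in> T3" "g \<in> carrier G"
  shows "act g ` s \<in> T3"
  unfolding triples_iff
proof (intro conjI ballI)
  have s: "s \<subseteq> bdry" "card s = 3" "\<And>D. D \<in> \<D> \<Longrightarrow> s \<inter> fst D = {}"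
    using assms(1) unfolding triples_iff by auto
  show "act g ` s \<subseteq> bdry" using s(1) act_bdry assms(2) by auto
  show "card (act g ` s) = 3"
    using card_image[OF inj_on_subset[OF inj_on_act[OF assms(2)] s(1)]] s(2) by simp
  fix D assume D: "D \<in> \<D>"
  have "s \<inter> fst (dact (inv g) D) = {}" by (rule s(3)[OF dact_closed[OF D inv_closed[OF assms(2)]]])
  moreover have "x \<in> fst (dact (inv g) D)" if "x \<in> s" "act g x \<in> fst D" for x
  proof -
    have "act (inv g) (act g x) = x"
      using act_inv_act(1)[OF _ assms(2)] that(1) s(1) bdry_subset_bord by auto
    then show ?thesis unfolding fst_dact using that(2) by (metis imageI)
  qed
  ultimately show "act g ` s \<inter> fst D = {}" by auto
qed

lemma act_halfspace:
  assumes "E \<subseteq> bdry" "g \<in> carrier G"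
  shows "(`) (act g) ` W E = W (act g ` E)"
proof -
  have sub: "(`) (act g) ` W E \<subseteq> W (act g ` E)" if "E \<subseteq> bdry" "g \<in> carrier G" for E g
  proof (rule image_subsetI)
    fix s assume "s \<in> W E"
    then have s: "s \<in> T3" "2 \<le> card (s \<inter> E)" unfolding halfspace_iff by simp_all
    have "s \<subseteq> bdry" using s(1) unfolding triples_iff by simp
    have "act g ` s \<inter> act g ` E = act g ` (s \<inter> E)"
      using inj_on_image_Int[OF inj_on_act[OF that(2)] \<open>s \<subseteq> bdry\<close> that(1)] by simp
    moreover have "card (act g ` (s \<inter> E)) = card (s \<inter> E)"
      by (rule card_image) (rule inj_on_subset[OF inj_on_act[OF that(2)]], use that(1) in auto)
    ultimately show "act g ` s \<in> W (act g ` E)"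
      unfolding halfspace_iff using s act_triple[OF s(1) that(2)] by simp
  qed
  have gE: "act g ` E \<subseteq> bdry" using act_bdry assms by auto
  have "W (act g ` E) \<subseteq> (`) (act g) ` W E"
  proof
    fix s assume s: "s \<in> W (act g ` E)"
    then have "s \<subseteq> bdry" unfolding halfspace_iff triples_iff by simp
    have "act (inv g) ` s \<in> W (act (inv g) ` act g ` E)"
      using sub[OF gE inv_closed[OF assms(2)]] s by auto
    then have "act (inv g) ` s \<in> W E" by (simp add: act_inv_image(1)[OF assms])
    then have "act g ` act (inv g) ` s \<in> (`) (act g) ` W E" by (rule imageI)
    then show "s \<in> (`) (act g) ` W E" by (simp add: act_inv_image(2)[OF \<open>s \<subseteq> bdry\<close> assms(2)])
  qed
  with sub[OF assms] show ?thesis by (rule equalityI)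
qed

abbreviation Gv :: "'a set" where "Gv \<equiv> stabilizer G (ultrafilter_act act) v"

text \<open>By \<open>vertex_eq\<close> the vertex and the choice \<open>h\<close> carry the same
  information, and \<open>W\<close> commutes with the action; fixing \<open>v\<close> is thus
  equivariance of \<open>h\<close>.\<close>

lemma stabilizer_iff:
  "g \<in> Gv \<longleftrightarrow> g \<in> carrier G \<and> (\<forall>D\<in>\<D>. h (dact g D) = act g ` h D)"
proof (cases "g \<in> carrier G")
  case g: True
  have hb: "h D \<subseteq> bdry" if "D \<in> \<D>" for D using chosen_subset[OF that] by simp
  have side: "act g ` h D \<in> snd (dact g D)" if "D \<in> \<D>" for D
    unfolding snd_dact using chosen_side(1)[OF that] by (rule imageI)
  have gv: "ultrafilter_act act g v = (\<lambda>D. W (act g ` h D)) ` \<D>"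
    unfolding ultrafilter_act_def
    by (subst vertex_eq) (simp add: image_image act_halfspace[OF hb g, unfolded image_image] cong: image_cong)
  have "ultrafilter_act act g v = v \<longleftrightarrow> (\<forall>D\<in>\<D>. h (dact g D) = act g ` h D)"
  proof
    assume fixed: "ultrafilter_act act g v = v"
    show "\<forall>D\<in>\<D>. h (dact g D) = act g ` h D"
    proof
      fix D assume D: "D \<in> \<D>"
      have "W (act g ` h D) \<in> v" using D fixed gv by auto
      then show "h (dact g D) = act g ` h D"
        by (rule chosen_eqI[OF dact_closed[OF D g] side[OF D]])
    qed
  next
    assume h: "\<forall>D\<in>\<D>. h (dact g D) = act g ` h D"
    have "dact g ` \<D> = \<D>"
    proof
      show "dact g ` \<D> \<subseteq> \<D>" using dact_closed g by auto
      show "\<D> \<subseteq> dact g ` \<D>"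
      proof
        fix D assume D: "D \<in> \<D>"
        show "D \<in> dact g ` \<D>"
          using dact_inv(2)[OF D g] dact_closed[OF D inv_closed[OF g]] by (metis imageI)
      qed
    qed
    then have "v = (\<lambda>D. W (h D)) ` dact g ` \<D>" using vertex_eq by simp
    also have "\<dots> = (\<lambda>D. W (act g ` h D)) ` \<D>" unfolding image_image using h by (auto cong: image_cong)
    finally show "ultrafilter_act act g v = v" using gv by simp
  qed
  then show ?thesis using g unfolding stabilizer_def by simp
next
  case False
  then show ?thesis unfolding stabilizer_def by simp
qed

lemma stabilizer_subset: "Gv \<subseteq> carrier G"
  unfolding stabilizer_def by auto

section \<open>Limit points lie in every closed chosen side\<close>

lemma limit_set_subset:
  assumes p: "p \<in> limit_set G S Gv" and D: "D \<in> \<D>"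
  shows "p \<in> h D \<union> fst D"
proof (rule ccontr)
  assume out: "p \<notin> h D \<union> fst D"
  have pb: "p \<in> bdry" and ex: "\<forall>n. \<exists>k. k \<in> Gv \<and> near (real n) p (group_point k)"
    using p limit_set_iff[OF stabilizer_subset] by auto
  from choice[OF ex] obtain k where k: "\<forall>n. k n \<in> Gv \<and> near (real n) p (group_point (k n))" ..
  then have kc: "k n \<in> carrier G" for n using stabilizer_subset by auto
  have k_p: "tends_to (\<lambda>n. group_point (k n)) p"
    unfolding tends_to_def eventually_sequentially
  proof
    fix r
    have "near r p (group_point (k n))" if "n \<ge> nat \<lceil>r\<rceil>" for n
      by (rule near_antimono[of "real n"]) (use k that in \<open>auto simp: nat_le_iff ceiling_le_iff\<close>)
    then show "\<exists>N. \<forall>n\<ge>N. near r p (group_point (k n))" by meson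
  qed
  have "filterlim (\<lambda>n. len (inv (k n))) at_top sequentially"
    unfolding filterlim_at_top
  proof
    fix N
    have "\<forall>\<^sub>F n in sequentially. real N \<le> real (len (k n))"
      by (rule tends_to_len[OF k_p pb]) (use kc in auto)
    then show "\<forall>\<^sub>F n in sequentially. N \<le> len (inv (k n))"
      by eventually_elim (simp add: len_inv kc)
  qed
  then obtain q and \<phi> :: "nat \<Rightarrow> nat" where q: "q \<in> bdry" "strict_mono \<phi>"
    "tends_to (\<lambda>n. group_point (inv (k (\<phi> n)))) q"
    by (rule group_seq_compact[rotated]) (use kc in auto)
  \<comment> \<open>The radius must not depend on the division: it is applied below to a translate
    of \<open>D\<close> that varies with \<open>n\<close>.\<close>
  obtain R where R: "\<And>D. D \<in> \<D> \<Longrightarrow> \<exists>x\<in>h D \<union> fst D. \<not> near R q x"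
    by (rule chosen_sides_spread[OF q(1)]) blast
  obtain R' where R': "\<And>x. x \<in> h D \<union> fst D \<Longrightarrow> \<not> near R' p x"
    by (rule side_not_near[OF D chosen_side(1)[OF D] pb out]) blast
  have k_p': "tends_to (\<lambda>n. group_point (inv (inv (k (\<phi> n))))) p"
    using tends_to_filterlim[OF k_p filterlim_subseq[OF q(2)]] kc by simp
  \<comment> \<open>The dynamics is applied to the inverses, so \<open>p\<close> is now the
    repelling point and the closed side of \<open>D\<close> avoids it.\<close>
  have "\<forall>\<^sub>F n in sequentially. \<forall>x\<in>bdry. \<not> near R' p x \<longrightarrow> near R q (act (inv (k (\<phi> n))) x)"
    by (rule convergence_dynamics[OF _ q(1) pb q(3) k_p']) (use kc in auto)
  then obtain n where n: "\<forall>x\<in>bdry. \<not> near R' p x \<longrightarrow> near R q (act (inv (k (\<phi> n))) x)"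
    using eventually_happens'[OF sequentially_bot] by auto
  let ?k = "k (\<phi> n)" and ?D = "dact (inv (k (\<phi> n))) D"
  have D': "?D \<in> \<D>" by (rule dact_closed[OF D inv_closed[OF kc]])
  have "h (dact ?k ?D) = act ?k ` h ?D" using k D' unfolding stabilizer_iff by simp
  then have hD: "h D = act ?k ` h ?D" using dact_inv(2)[OF D kc] by simp
  have "h ?D \<subseteq> bdry" using chosen_subset[OF D'] by simp
  then have "h ?D = act (inv ?k) ` h D" unfolding hD using act_inv_image(1)[OF _ kc] by simp
  then have "h ?D \<union> fst ?D = act (inv ?k) ` (h D \<union> fst D)" by (simp add: fst_dact image_Un)
  then obtain x where "x \<in> h D \<union> fst D" "\<not> near R q (act (inv ?k) x)" using R[OF D'] by auto
  then show False using n R' chosen_subset[OF D] by auto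
qed

section \<open>Points of all closed chosen sides are limit points\<close>

lemma near_group_point_mult:
  assumes "g \<in> carrier G" "u \<in> carrier G"
  shows "near (real (len g) - real (len u)) (group_point g) (group_point (g \<otimes> u))"
proof -
  have "gp (inv g) u \<le> len u" using gp_commute gp_le_len assms by (metis inv_closed)
  then show ?thesis unfolding near_group_point using gp_inverse_sum[OF assms] by linarith
qed

text \<open>Here \<open>H n\<close> is the choice of sides made by the vertex \<open>inv (g n) v\<close>. Only finitely many of these
  vertices are distinct because they differ from \<open>principal_ultrafilter X \<D> t\<close> in finitely many walls
  altogether: otherwise small sides would shrink to the limit \<open>a\<close> of the points \<open>inv (g n) p\<close>, while
  the spread of the chosen sides forces them to accumulate at \<open>b\<close>.\<close>

context
  fixes g :: "nat \<Rightarrow> 'a" and p a b :: "'a bpoint"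
    and H :: "nat \<Rightarrow> 'a bpoint division \<Rightarrow> 'a bpoint set" and B :: "nat \<Rightarrow> 'a bpoint division set"
  assumes p: "p \<in> bdry" and p_in: "\<And>D. D \<in> \<D> \<Longrightarrow> p \<in> h D \<union> fst D"
    and g: "range g \<subseteq> carrier G" and a: "a \<in> bdry" and b: "b \<in> bdry" and a_neq_b: "a \<noteq> b"
    and g_p: "tends_to (\<lambda>n. group_point (g n)) p"
    and g_b: "tends_to (\<lambda>n. group_point (inv (g n))) b"
    and g_a: "tends_to (\<lambda>n. act (inv (g n)) p) a"
  defines "H \<equiv> \<lambda>n D. act (inv (g n)) ` h (dact (g n) D)"
    and "B \<equiv> \<lambda>n. {D \<in> \<D>. t \<notin> W (H n D)}"
begin

lemma ray_closed: "g n \<in> carrier G"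
  using g by auto

lemma H_side:
  assumes "D \<in> \<D>"
  shows "H n D \<in> snd D"
proof -
  have "H n D \<in> (`) (act (inv (g n))) ` snd (dact (g n) D)"
    unfolding H_def by (rule imageI) (rule chosen_side(1)[OF dact_closed[OF assms ray_closed]])
  then show ?thesis by (simp add: snd_dact[symmetric] dact_inv(1)[OF assms ray_closed])
qed

lemma H_closed_side:
  assumes "D \<in> \<D>"
  shows "act (inv (g n)) ` (h (dact (g n) D) \<union> fst (dact (g n) D)) = H n D \<union> fst D"
  using act_inv_image(1)[OF wall_subset[OF assms] ray_closed] unfolding H_def by (simp add: image_Un fst_dact)

text \<open>Infinitely many exceptions would contain sides \<open>H n D\<close> shrinking to some
  \<open>q\<close>. Applying the fixed element \<open>g n\<close>, closed sides chosen by
  \<open>v\<close> itself would shrink to \<open>act (g n) q\<close>, against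
  \<open>chosen_sides_spread\<close>.\<close>

lemma finite_differences: "finite (B n)"
proof (rule ccontr)
  assume "infinite (B n)"
  from infinite_countable_subset[OF this]
  obtain D :: "nat \<Rightarrow> 'a bpoint division" where D: "inj D" "range D \<subseteq> B n"
    by (elim exE conjE)
  then have DD: "range D \<subseteq> \<D>" "D i \<in> \<D>" "t \<notin> W (H n (D i))" for i unfolding B_def by auto
  obtain \<phi> :: "nat \<Rightarrow> nat" and N q where N: "strict_mono \<phi>" "q \<in> bdry" "\<And>i. N i \<in> snd (D (\<phi> i))"
    "\<And>r. \<forall>\<^sub>F i in sequentially. \<forall>x\<in>N i \<union> fst (D (\<phi> i)). near r q x"
    by (rule small_sides[OF D(1) DD(1)]) (rule that)
  obtain R where R: "\<And>D. D \<in> \<D> \<Longrightarrow> \<exists>x\<in>h D \<union> fst D. \<not> near R (act (g n) q) x"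
    by (rule chosen_sides_spread[OF act_bdry[OF N(2) ray_closed]]) blast
  \<comment> \<open>The surplus \<open>len (g n)\<close> is what \<open>near_act\<close> loses when
    \<open>g n\<close> is applied.\<close>
  have "\<forall>\<^sub>F i in sequentially. t \<notin> W (N i) \<and> (\<forall>x\<in>N i \<union> fst (D (\<phi> i)). near (R + len (g n)) q x)"
    by (rule eventually_conj[OF eventually_notin_small_halfspace[OF t_triple N(2,4)] N(4)])
  then obtain i where i: "t \<notin> W (N i)" "\<forall>x\<in>N i \<union> fst (D (\<phi> i)). near (R + len (g n)) q x"
    using eventually_happens'[OF sequentially_bot] by auto
  have "N i = H n (D (\<phi> i))"
    by (rule side_eqI[OF DD(2) N(3) H_side[OF DD(2)] t_triple]) (use i(1) DD(3) in simp)
  obtain x where x: "x \<in> h (dact (g n) (D (\<phi> i))) \<union> fst (dact (g n) (D (\<phi> i)))"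
    "\<not> near R (act (g n) q) x"
    using R[OF dact_closed[OF DD(2) ray_closed]] by metis
  have xb: "x \<in> bord"
    by (rule subsetD[OF bdry_subset_bord subsetD[OF chosen_subset[OF dact_closed[OF DD(2) ray_closed]] x(1)]])
  have "act (inv (g n)) x \<in> H n (D (\<phi> i)) \<union> fst (D (\<phi> i))"
    unfolding H_closed_side[OF DD(2), symmetric] using x(1) by (rule imageI)
  then have "near (R + len (g n)) q (act (inv (g n)) x)"
    using i(2) \<open>N i = H n (D (\<phi> i))\<close> by simp
  from near_act[OF subsetD[OF bdry_subset_bord N(2)] act_bord[OF xb inv_closed[OF ray_closed]] ray_closed[of n] this]
  show False using x(2) act_inv_act(2)[OF xb ray_closed, of n] by simp
qed

lemma finite_UN_differences: "finite (\<Union>n. B n)"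
proof (rule ccontr)
  assume "infinite (\<Union>n. B n)"
  from infinite_countable_subset[OF this]
  obtain D :: "nat \<Rightarrow> 'a bpoint division" where D: "inj D" "range D \<subseteq> (\<Union>n. B n)"
    by (elim exE conjE)
  have ex: "\<exists>n. D i \<in> B n" for i using D(2) by auto
  define m where "m i = (LEAST n. D i \<in> B n)" for i
  have m: "D i \<in> B (m i)" for i unfolding m_def by (rule LeastI_ex[OF ex])
  then have DD: "range D \<subseteq> \<D>" "D i \<in> \<D>" "t \<notin> W (H (m i) (D i))" for i unfolding B_def by auto
  \<comment> \<open>By \<open>finite_differences\<close>, the indices up to \<open>K\<close> account
    for finitely many of the distinct divisions \<open>D i\<close>. The resulting index sequence
    need not be monotone, so limits are transported along it by
    \<open>tends_to_filterlim\<close>.\<close>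
  have lim_m: "filterlim m at_top sequentially"
    unfolding filterlim_at_top
  proof
    fix K
    define A where "A = D -` (\<Union>n\<le>K. B n)"
    have "finite A"
      unfolding A_def using finite_differences D(1) by (intro finite_vimageI) auto
    then have "\<forall>\<^sub>F i in sequentially. i \<notin> A"
      by (simp add: eventually_cofinite flip: cofinite_eq_sequentially)
    then show "\<forall>\<^sub>F i in sequentially. K \<le> m i"
    proof eventually_elim
      case (elim i)
      then have "D i \<notin> B (m i) \<or> \<not> m i \<le> K" unfolding A_def by auto
      then show ?case using m[of i] by auto
    qed
  qed
  obtain \<phi> :: "nat \<Rightarrow> nat" and N q where N: "strict_mono \<phi>" "q \<in> bdry" "\<And>i. N i \<in> snd (D (\<phi> i))"
    "\<And>r. \<forall>\<^sub>F i in sequentially. \<forall>x\<in>N i \<union> fst (D (\<phi> i)). near r q x"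
    by (rule small_sides[OF D(1) DD(1)]) (rule that)
  define k where "k i = g (m (\<phi> i))" for i
  have kc: "k i \<in> carrier G" for i using ray_closed by (simp add: k_def)
  have lim: "filterlim (\<lambda>i. m (\<phi> i)) sequentially sequentially"
    by (rule filterlim_compose[OF lim_m filterlim_subseq[OF N(1)]])
  have kD: "dact (k i) (D (\<phi> i)) \<in> \<D>" for i by (rule dact_closed[OF DD(2) kc])
  have small: "\<forall>\<^sub>F i in sequentially. \<forall>x\<in>h (dact (k i) (D (\<phi> i))) \<union> fst (dact (k i) (D (\<phi> i))).
      near r q (act (inv (k i)) x)" for r
    using eventually_notin_small_halfspace[OF t_triple N(2,4)] N(4)[of r]
  proof eventually_elim
    case (elim i)
    have "N i = H (m (\<phi> i)) (D (\<phi> i))"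
      by (rule side_eqI[OF DD(2) N(3) H_side[OF DD(2)] t_triple]) (use elim(1) DD(3) in simp)
    then show ?case
      using elim(2) H_closed_side[OF DD(2), of "m (\<phi> i)" "\<phi> i", symmetric] unfolding k_def by auto
  qed
  \<comment> \<open>Since \<open>p\<close> lies in every closed chosen side, its image under
    \<open>inv (k i)\<close> lies in the shrinking one.\<close>
  have "q = a"
  proof (rule near_both_eq[OF N(2) a])
    fix r
    have "\<forall>\<^sub>F i in sequentially. near r a (act (inv (k i)) p)"
      using tends_to_filterlim[OF g_a lim] unfolding tends_to_def k_def by simp
    with small[of r] have "\<forall>\<^sub>F i in sequentially. near r q (act (inv (k i)) p) \<and> near r a (act (inv (k i)) p)"
      by eventually_elim (use p_in[OF kD] in auto)
    then obtain i where "near r q (act (inv (k i)) p) \<and> near r a (act (inv (k i)) p)"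
      using eventually_happens'[OF sequentially_bot] by auto
    moreover have "act (inv (k i)) p \<in> bord"
      by (rule subsetD[OF bdry_subset_bord act_bdry[OF p inv_closed[OF kc]]])
    ultimately show "\<exists>s\<in>bord. near r q s \<and> near r a s" by (intro bexI)
  qed
  \<comment> \<open>Each closed chosen side also has a point outside a fixed neighbourhood of
    \<open>p\<close>, and \<open>inv (k i)\<close> sends such points towards
    \<open>b\<close>.\<close>
  moreover have "q = b"
  proof (rule near_both_eq[OF N(2) b])
    fix r
    obtain R where R: "\<And>D. D \<in> \<D> \<Longrightarrow> \<exists>x\<in>h D \<union> fst D. \<not> near R p x"
      by (rule chosen_sides_spread[OF p]) blast
    have "\<forall>\<^sub>F n in sequentially. \<forall>x\<in>bdry. \<not> near R p x \<longrightarrow> near r b (act (inv (g n)) x)"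
      by (rule convergence_dynamics[OF _ b p g_b]) (use g_p ray_closed in auto)
    then have "\<forall>\<^sub>F i in sequentially. \<forall>x\<in>bdry. \<not> near R p x \<longrightarrow> near r b (act (inv (k i)) x)"
      unfolding k_def by (rule eventually_compose_filterlim[OF _ lim])
    from eventually_happens'[OF sequentially_bot eventually_conj[OF this small[of r]]]
    obtain i where i: "\<forall>x\<in>bdry. \<not> near R p x \<longrightarrow> near r b (act (inv (k i)) x)"
      "\<forall>x\<in>h (dact (k i) (D (\<phi> i))) \<union> fst (dact (k i) (D (\<phi> i))). near r q (act (inv (k i)) x)"
      by (elim exE conjE)
    obtain x where x: "x \<in> h (dact (k i) (D (\<phi> i))) \<union> fst (dact (k i) (D (\<phi> i)))" "\<not> near R p x"
      using R[OF kD] by metis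
    have xb: "x \<in> bdry" using x(1) chosen_subset[OF kD] by auto
    have "near r q (act (inv (k i)) x)" "near r b (act (inv (k i)) x)" using i x xb by simp_all
    moreover have "act (inv (k i)) x \<in> bord"
      by (rule subsetD[OF bdry_subset_bord act_bdry[OF xb inv_closed[OF kc]]])
    ultimately show "\<exists>s\<in>bord. near r q s \<and> near r b s" by auto
  qed
  ultimately show False using a_neq_b by simp
qed

text \<open>The sets \<open>B n\<close> are subsets of one finite set, so some \<open>B0\<close>
  recurs. Equal sets mean that \<open>t\<close> decides every wall alike, hence
  \<open>H (s i)\<close> = \<open>H (s 0)\<close>, and
  \<open>g (s i) \<otimes> inv (g (s 0))\<close> fixes \<open>v\<close>. The fixed right factor does
  not change the limit.\<close>

lemma stabilizer_tends_to: "\<exists>k. range k \<subseteq> Gv \<and> tends_to (\<lambda>n. group_point (k n)) p"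
proof -
  have "range B \<subseteq> Pow (\<Union>n. B n)" by auto
  then have "finite (range B)" using finite_UN_differences by (meson finite_Pow_iff finite_subset)
  then obtain B0 and s :: "nat \<Rightarrow> nat" where s: "strict_mono s" "\<And>i. B (s i) = B0"
    by (rule ex_constant_subseq) blast
  define u where "u = inv (g (s 0))"
  have uc: "u \<in> carrier G" using ray_closed by (simp add: u_def)
  define k where "k i = g (s i) \<otimes> u" for i
  have kc: "k i \<in> carrier G" for i using ray_closed uc by (simp add: k_def)
  have "k i \<in> Gv" for i
    unfolding stabilizer_iff
  proof (intro conjI ballI kc)
    fix D assume D: "D \<in> \<D>"
    define D1 where "D1 = dact u D"
    have D1: "D1 \<in> \<D>" unfolding D1_def by (rule dact_closed[OF D uc])
    have "D1 \<in> B (s i) \<longleftrightarrow> D1 \<in> B (s 0)" using s(2) by simp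
    then have "t \<in> W (H (s i) D1) \<longleftrightarrow> t \<in> W (H (s 0) D1)" using D1 unfolding B_def by simp
    then have "H (s i) D1 = H (s 0) D1"
      by (rule side_eqI[OF D1 H_side[OF D1] H_side[OF D1] t_triple])
    moreover have "dact (g (s 0)) D1 = D"
      unfolding D1_def u_def by (rule dact_inv(2)[OF D ray_closed])
    ultimately have eq: "act (inv (g (s i))) ` h (dact (g (s i)) D1) = act u ` h D"
      unfolding H_def u_def by simp
    have kD: "dact (k i) D = dact (g (s i)) D1"
      unfolding k_def D1_def by (rule dact_mult[OF D ray_closed uc])
    have "h (dact (g (s i)) D1) \<subseteq> bdry" using chosen_subset[OF dact_closed[OF D1 ray_closed]] by simp
    then have "h (dact (g (s i)) D1) = act (g (s i)) ` act u ` h D"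
      using act_inv_image(2)[OF _ ray_closed] eq by metis
    also have "\<dots> = act (k i) ` h D"
      unfolding k_def using act_mult_image[OF _ ray_closed uc] chosen_subset[OF D] by simp
    finally show "h (dact (k i) D) = act (k i) ` h D" unfolding kD .
  qed
  then have "range k \<subseteq> Gv" by auto
  moreover have "tends_to (\<lambda>n. group_point (k n)) p"
  proof (rule tends_to_near)
    show g_s: "tends_to (\<lambda>n. group_point (g (s n))) p"
      by (rule tends_to_filterlim[OF g_p filterlim_subseq[OF s(1)]])
    show "p \<in> bord" using p bdry_subset_bord by auto
    show "range (\<lambda>n. group_point (g (s n))) \<subseteq> bord" "range (\<lambda>n. group_point (k n)) \<subseteq> bord"
      using group_point_bord ray_closed kc by auto
    fix r
    have "\<forall>\<^sub>F n in sequentially. r + real (len u) \<le> real (len (g (s n)))"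
      by (rule tends_to_len[OF g_s p]) (use ray_closed in auto)
    then show "\<forall>\<^sub>F n in sequentially. near r (group_point (g (s n))) (group_point (k n))"
    proof eventually_elim
      case (elim n)
      show ?case
        unfolding k_def by (rule near_antimono[OF near_group_point_mult[OF ray_closed uc]]) (use elim in simp)
    qed
  qed
  ultimately show ?thesis by auto
qed

end

lemma subset_limit_set:
  assumes "p \<in> bdry" "\<And>D. D \<in> \<D> \<Longrightarrow> p \<in> h D \<union> fst D"
  shows "p \<in> limit_set G S Gv"
proof -
  obtain g a b where g: "range g \<subseteq> carrier G" "a \<in> bdry" "b \<in> bdry" "a \<noteq> b"
    "tends_to (\<lambda>n. group_point (g n)) p" "tends_to (\<lambda>n. group_point (inv (g n))) b"
    "tends_to (\<lambda>n. act (inv (g n)) p) a"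
    using conical_dynamics[OF assms(1)] by metis
  obtain k where k: "range k \<subseteq> Gv" "tends_to (\<lambda>n. group_point (k n)) p"
    using stabilizer_tends_to[OF assms g] by auto
  have "\<exists>h\<in>Gv. near r p (group_point h)" for r
  proof -
    have "\<forall>\<^sub>F n in sequentially. near r p (group_point (k n))"
      using k(2) unfolding tends_to_def by simp
    then obtain n where "near r p (group_point (k n))"
      using eventually_happens'[OF sequentially_bot] by auto
    then show ?thesis using k(1) by auto
  qed
  then show ?thesis using limit_set_iff[OF stabilizer_subset] assms(1) by simp
qed

end

theorem theoremB:
  fixes G :: "('a, 'b) monoid_scheme" and S :: "'a set"
    and \<D> :: "'a bpoint division set" and v :: "'a bpoint set set set"
  assumes "hyperbolic_group G S"
    and "\<exists>p\<in>gromov_boundary G S. \<exists>q\<in>gromov_boundary G S. p \<noteq> q"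
    and "path_connected_space (boundary_topology G S)"
    and "\<nexists>p. path_cut_point (boundary_topology G S) p"
    and "\<forall>D\<in>\<D>. is_division (boundary_topology G S) D \<and> full_division G (boundary_act G) D"
    and "G_finite G (boundary_act G) \<D>"
    and "point_convergent (boundary_topology G S) \<D>"
    and "v \<in> dual_complex_vertices (boundary_topology G S) \<D>"
  shows "limit_set G S (stabilizer G (ultrafilter_act (boundary_act G)) v) =
         gromov_boundary G S \<inter>
           (\<Inter>D\<in>\<D>. chosen_side (boundary_topology G S) \<D> v D \<union> fst D)"
proof -
  interpret hyperbolic_group G S by fact
  obtain \<delta>0 where \<delta>0: "\<forall>w\<in>carrier G. \<forall>x\<in>carrier G. \<forall>y\<in>carrier G. \<forall>z\<in>carrier G.
      min (gromov_product G S w x y) (gromov_product G S w y z) - \<delta>0 \<le> gromov_product G S w x z"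
    using hyperbolic by auto
  \<comment> \<open>Enlarging the constant only weakens the hyperbolic inequality; this secures
    nonnegativity.\<close>
  define \<delta> where "\<delta> = max 0 \<delta>0"
  interpret hyperbolic_group_const G S \<delta>
  proof
    show "0 \<le> \<delta>" by (simp add: \<delta>_def)
    fix x y z assume "x \<in> carrier G" "y \<in> carrier G" "z \<in> carrier G"
    then have "min (gp x y) (gp y z) - \<delta>0 \<le> gp x z" using \<delta>0 by simp
    then show "min (gp x y) (gp y z) - \<delta> \<le> gp x z" unfolding \<delta>_def by linarith
  qed
  interpret division_system G S \<delta> \<D>
    by unfold_locales (use assms in auto)
  obtain t where t: "t \<in> triples (boundary_topology G S) \<D>"
    "finite (v - principal_ultrafilter (boundary_topology G S) \<D> t)"
    using dual_complex_vertex_finite_diff[OF assms(8)] .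
  have "wall_ultrafilter (boundary_topology G S) \<D> v"
    using assms(8) unfolding dual_complex_vertices_def Z_vertices_def by simp
  then interpret division_vertex G S \<delta> \<D> v t
    using t by unfold_locales
  show ?thesis
  proof
    show "limit_set G S Gv \<subseteq> bdry \<inter> (\<Inter>D\<in>\<D>. h D \<union> fst D)"
    proof
      fix p assume p: "p \<in> limit_set G S Gv"
      then have "p \<in> bdry" by (simp add: limit_set_def)
      then show "p \<in> bdry \<inter> (\<Inter>D\<in>\<D>. h D \<union> fst D)" using limit_set_subset[OF p] by auto
    qed
    show "bdry \<inter> (\<Inter>D\<in>\<D>. h D \<union> fst D) \<subseteq> limit_set G S Gv"
      using subset_limit_set by auto
  qed
qed

end
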